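(* Let $n\ge2$, $\mathbf t=(t_0,u_0,t,t_n,u_n)\in\mathbb C^5$, and let $\mathcal H=\mathcal H(\mathbf t)$ be the rational double affine Hecke algebra defined in the context. For every $w\in W$ fix a reduced expression $\overline w=s_{i_1}\cdots s_{i_r}$ and put $T_{\overline w}=T_{i_1}\cdots T_{i_r}$. Then each of the two sets $$\{X^{\phi(\lambda)}T_{\overline w}\mid \lambda\in\Lambda,\ w\in W\},\qquad \{T_{\overline w}X^{\phi(\lambda)}\mid \lambda\in\Lambda,\ w\in W\}$$ is a linear basis of $\mathcal H$.
   Context: Notation: $[m,n]=\{m,m+1,\dots,n\}$; $\Lambda=\mathbb Z^n$. The bijection $\phi:\mathbb Z\to\mathbb Z_{\ge0}$ is $\phi(m)=2m$ for $m\ge0$, $\phi(m)=-2m-1$ for $m<0$; for $\lambda\in\Lambda$, $\phi(\lambda)=(\phi(\lambda_1),\dots,\phi(\lambda_n))$ and $X^{\mu}=X_1^{\mu_1}\cdots X_n^{\mu_n}$. $W$ is the affine Weyl group of type $\widetilde C_n$: the Coxeter group with generators $s_0,\dots,s_n$ and relations $s_i^2=1$; $s_is_{i+1}s_is_{i+1}=s_{i+1}s_is_{i+1}s_i$ for $i=0,n-1$; $s_is_{i+1}s_i=s_{i+1}s_is_{i+1}$ for $i\in[1,n-2]$; $s_is_j=s_js_i$ for $|i-j|\ge2$. $W$ acts on $\mathbb C^n$ by $s_0x=(1-x_1,x_2,\dots,x_n)$, $s_i$ interchanges $x_i$ and $x_{i+1}$ ($i\in[1,n-1]$), $s_nx=(x_1,\dots,x_{n-1},-x_n)$,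 and on $\mathcal P=\mathbb C[x_1,\dots,x_n]$ by $(wp)(x)=p(w^{-1}x)$. Put $a_0(x)=1-2x_1$, $a_i(x)=x_i-x_{i+1}$ ($i\in[1,n-1]$), $a_n(x)=2x_n$, and $a_0^\vee(x)=\tfrac12-x_1$, $a_n^\vee(x)=x_n$. Put $k_0=2t_0+2u_0$, $k_i=t$ for $i\in[1,n-1]$, $k_n=2t_n+2u_n$. The degenerate (trigonometric) double affine Hecke algebra $\mathfrak H(\mathbf k)$ is the unital associative complex algebra generated by the group algebra $\mathbb C[W]$ (with generators $r_0,\dots,r_n$ corresponding to $s_0,\dots,s_n$) and $\mathbb C[X_1,\dots,X_n]$, such that $\mathfrak H(\mathbf k)\simeq\mathbb C[W]\otimes\mathbb C[X_1,\dots,X_n]$ as a vector space via multiplication, with cross-relations $$r_ip(X)-(s_ip)(X)r_i=\frac{k_i}{a_i(X)}\big((s_ip)(X)-p(X)\big),\qquad i\in[0,n],\ p\in\mathcal P .$$ $H$ is the subalgebra of $\mathfrak H(\mathbf k)$ generated by $T_i=r_i$ ($i\in[1,n-1]$) and $T_i=t_i+\tfrac12\big(t_i-u_i+a_i^\vee(X)\big)(r_i-1)$ for $i=0,n$. The rational double affine Hecke algebra $\mathcal H=\mathcal H(\mathbf t)$ is the subalgebra of $\mathfrak H(\mathbf k)$ generated by $H$ and $X_1,\dots,X_n$. *)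

theory Defs
  imports Complex_Main "HOL-Library.Poly_Mapping" "HOL-Library.FuncSet"
begin

section \<open>Associative algebras and linear bases\<close>

locale complex_algebra = vector_space scale
  for scale :: "complex \<Rightarrow> 'a::ring_1 \<Rightarrow> 'a" +
  assumes scale_mult_left: "scale c (a * b) = scale c a * b"
    and scale_mult_right: "scale c (a * b) = a * scale c b"

definition is_subalgebra :: "(complex \<Rightarrow> 'a::ring_1 \<Rightarrow> 'a) \<Rightarrow> 'a set \<Rightarrow> bool" where
  "is_subalgebra scale B \<longleftrightarrow> 1 \<in> B \<and> (\<forall>a\<in>B. \<forall>b\<in>B. a + b \<in> B \<and> a * b \<in> B)
     \<and> (\<forall>c. \<forall>a\<in>B. scale c a \<in> B)"

text \<open>The family \<open>b\<close> indexed by \<open>I\<close> is a basis of the subspace \<open>V\<close>; distinct indices are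
  required to give distinct basis vectors.\<close>
definition is_linear_basis ::
    "(complex \<Rightarrow> 'a::ring_1 \<Rightarrow> 'a) \<Rightarrow> 'i set \<Rightarrow> ('i \<Rightarrow> 'a) \<Rightarrow> 'a set \<Rightarrow> bool" where
  "is_linear_basis scale I b V \<longleftrightarrow>
     inj_on b I \<and> \<not> module.dependent scale (b ` I) \<and> module.span scale (b ` I) = V"


section \<open>Polynomials\<close>

text \<open>Finitely supported exponent functions index monomials, and \<open>'k \<Rightarrow>\<^sub>0 complex\<close> carries the
  convolution product; \<open>polys n\<close> is the polynomial ring in the variables with indices
  \<open>1, \<dots>, n\<close>.\<close>
type_synonym cpoly = "(nat \<Rightarrow>\<^sub>0 nat) \<Rightarrow>\<^sub>0 complex"

definition polys :: "nat \<Rightarrow> cpoly set" where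
  "polys n = {p. \<forall>m\<in>Poly_Mapping.keys p. Poly_Mapping.keys m \<subseteq> {1..n}}"

definition Const :: "complex \<Rightarrow> cpoly" where
  "Const c = Poly_Mapping.single 0 c"

definition Var :: "nat \<Rightarrow> cpoly" where
  "Var j = Poly_Mapping.single (Poly_Mapping.single j 1) 1"

definition monomial :: "nat \<Rightarrow> (nat \<Rightarrow> 'a::ring_1) \<Rightarrow> (nat \<Rightarrow> nat) \<Rightarrow> 'a" where
  "monomial n X \<mu> = (\<Prod>j\<leftarrow>[1..<Suc n]. X j ^ \<mu> j)"

text \<open>\<open>poly_eval scale n X p\<close> is \<open>p(X\<^sub>1, \<dots>, X\<^sub>n)\<close> in an algebra with scalar multiplication
  \<open>scale\<close>, for pairwise commuting \<open>X\<^sub>j\<close>.\<close>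
definition poly_eval ::
    "(complex \<Rightarrow> 'a::ring_1 \<Rightarrow> 'a) \<Rightarrow> nat \<Rightarrow> (nat \<Rightarrow> 'a) \<Rightarrow> cpoly \<Rightarrow> 'a" where
  "poly_eval scale n X p =
     (\<Sum>m\<in>Poly_Mapping.keys p. scale (Poly_Mapping.lookup p m)
        (monomial n X (Poly_Mapping.lookup m)))"


section \<open>The Coxeter group of affine type C and its action\<close>

definition coxeter_relations :: "nat \<Rightarrow> (nat list \<times> nat list) set" where
  "coxeter_relations n =
     {([i, i], []) | i. i \<in> {0..n}}
   \<union> {([i, i+1, i, i+1], [i+1, i, i+1, i]) | i. i \<in> {0, n-1}}
   \<union> {([i, i+1, i], [i+1, i, i+1]) | i. i \<in> {1..n-2}}
   \<union> {([i, j], [j, i]) | i j. i \<in> {0..n} \<and> j \<in> {0..n} \<and> (i + 2 \<le> j \<or> j + 2 \<le> i)}"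

inductive coxeter_equiv :: "nat \<Rightarrow> nat list \<Rightarrow> nat list \<Rightarrow> bool" for n where
  refl: "set u \<subseteq> {0..n} \<Longrightarrow> coxeter_equiv n u u"
| sym: "coxeter_equiv n u v \<Longrightarrow> coxeter_equiv n v u"
| trans: "coxeter_equiv n u v \<Longrightarrow> coxeter_equiv n v w \<Longrightarrow> coxeter_equiv n u w"
| step: "set u \<subseteq> {0..n} \<Longrightarrow> set v \<subseteq> {0..n} \<Longrightarrow> (l, l') \<in> coxeter_relations n
         \<Longrightarrow> coxeter_equiv n (u @ l @ v) (u @ l' @ v)"

text \<open>The group presented by the relations above. As the generators are involutions, it agrees
  with the monoid with this presentation, so an element of the group is an equivalence class of
  words \<open>[i\<^sub>1, \<dots>, i\<^sub>r]\<close>, standing for \<open>s\<^bsub>i\<^sub>1\<^esub> \<dots> s\<^bsub>i\<^sub>r\<^esub>\<close>.\<close>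
definition coxeter_group :: "nat \<Rightarrow> nat list set set" where
  "coxeter_group n = lists {0..n} // {(u, v). coxeter_equiv n u v}"

definition reduced_expression :: "nat list set \<Rightarrow> nat list \<Rightarrow> bool" where
  "reduced_expression w u \<longleftrightarrow> u \<in> w \<and> (\<forall>v\<in>w. length u \<le> length v)"

text \<open>The coordinates of \<open>s\<^sub>i x\<close>, for \<open>x\<close> with entries in any ring, so that it applies to points
  as well as to the vector of variables.\<close>
definition reflect :: "nat \<Rightarrow> nat \<Rightarrow> (nat \<Rightarrow> 'a::ring_1) \<Rightarrow> nat \<Rightarrow> 'a" where
  "reflect n i x =
     (if i = 0 then x(1 := 1 - x 1)
      else if i = n then x(n := - x n)
      else x(i := x (i+1), i+1 := x i))"

text \<open>The action \<open>(s\<^sub>i p)(x) = p(s\<^sub>i\<^sup>-\<^sup>1 x) = p(s\<^sub>i x)\<close>, carried out by substitution; see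
  \<open>poly_eval_act\<close> below.\<close>
definition act :: "nat \<Rightarrow> nat \<Rightarrow> cpoly \<Rightarrow> cpoly" where
  "act n i p = poly_eval (\<lambda>c q. Const c * q) n (reflect n i Var) p"

definition affine_root :: "nat \<Rightarrow> nat \<Rightarrow> cpoly" where
  "affine_root n i =
     (if i = 0 then 1 - 2 * Var 1 else if i = n then 2 * Var n else Var i - Var (i+1))"

text \<open>Only meant for \<open>i = 0\<close> and \<open>i = n\<close>.\<close>
definition affine_coroot :: "nat \<Rightarrow> nat \<Rightarrow> cpoly" where
  "affine_coroot n i = (if i = 0 then Const (1/2) - Var 1 else Var n)"


section \<open>The degenerate double affine Hecke algebra\<close>

text \<open>The image of a group element under the homomorphism \<open>s\<^sub>i \<mapsto> r\<^sub>i\<close>: the common value of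
  \<open>r\<^bsub>i\<^sub>1\<^esub> \<dots> r\<^bsub>i\<^sub>m\<^esub>\<close> over all words in the class.\<close>
definition group_elem :: "(nat \<Rightarrow> 'a::ring_1) \<Rightarrow> nat list set \<Rightarrow> 'a" where
  "group_elem r w = the_elem ((\<lambda>u. prod_list (map r u)) ` w)"

text \<open>The tensor product of the group algebra with the polynomial ring, realised as the finitely
  supported functions from the group to the polynomials: \<open>w \<otimes> p\<close> is \<open>single w p\<close>.\<close>
definition group_poly_tensor :: "nat \<Rightarrow> (nat list set \<Rightarrow>\<^sub>0 cpoly) set" where
  "group_poly_tensor n = {f. \<forall>w\<in>Poly_Mapping.keys f.
     w \<in> coxeter_group n \<and> Poly_Mapping.lookup f w \<in> polys n}"

definition mult_map ::
    "(complex \<Rightarrow> 'a::ring_1 \<Rightarrow> 'a) \<Rightarrow> nat \<Rightarrow> (nat \<Rightarrow> 'a) \<Rightarrow> (nat \<Rightarrow> 'a)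
      \<Rightarrow> (nat list set \<Rightarrow>\<^sub>0 cpoly) \<Rightarrow> 'a" where
  "mult_map scale n r X f =
     (\<Sum>w\<in>Poly_Mapping.keys f. group_elem r w * poly_eval scale n X (Poly_Mapping.lookup f w))"

text \<open>The whole type \<open>'a\<close> is the algebra. That it is generated by the \<open>r\<^sub>i\<close> and \<open>X\<^sub>j\<close> follows from
  \<open>tensor_iso\<close>. In \<open>cross_relation\<close>, \<open>q\<close> is the quotient \<open>(s\<^sub>i p - p) / a\<^sub>i\<close>, which exists and
  is unique by \<open>ex1_quotient\<close> below.\<close>
locale degenerate_daha = complex_algebra scale
  for scale :: "complex \<Rightarrow> 'a::ring_1 \<Rightarrow> 'a" +
  fixes n :: nat and k :: "nat \<Rightarrow> complex" and r X :: "nat \<Rightarrow> 'a"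
  assumes group_relations:
      "(u, v) \<in> coxeter_relations n \<Longrightarrow> prod_list (map r u) = prod_list (map r v)"
    and X_commute: "i \<in> {1..n} \<Longrightarrow> j \<in> {1..n} \<Longrightarrow> X i * X j = X j * X i"
    and tensor_iso: "bij_betw (mult_map scale n r X) (group_poly_tensor n) UNIV"
    and cross_relation:
      "i \<in> {0..n} \<Longrightarrow> p \<in> polys n \<Longrightarrow> q \<in> polys n \<Longrightarrow> affine_root n i * q = act n i p - p \<Longrightarrow>
         r i * poly_eval scale n X p - poly_eval scale n X (act n i p) * r i
           = scale (k i) (poly_eval scale n X q)"


section \<open>The rational double affine Hecke algebra\<close>

definition daha_k ::
    "nat \<Rightarrow> complex \<Rightarrow> complex \<Rightarrow> complex \<Rightarrow> complex \<Rightarrow> complex \<Rightarrow> nat \<Rightarrow> complex" where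
  "daha_k n t0 u0 t tn un i =
     (if i = 0 then 2 * t0 + 2 * u0 else if i = n then 2 * tn + 2 * un else t)"

definition T_gen ::
    "(complex \<Rightarrow> 'a::ring_1 \<Rightarrow> 'a) \<Rightarrow> nat \<Rightarrow> (nat \<Rightarrow> 'a) \<Rightarrow> (nat \<Rightarrow> 'a)
      \<Rightarrow> complex \<Rightarrow> complex \<Rightarrow> complex \<Rightarrow> complex \<Rightarrow> nat \<Rightarrow> 'a" where
  "T_gen scale n r X t0 u0 tn un i =
     (let T = (\<lambda>a b. scale a 1 +
            scale (1/2) ((scale (a - b) 1 + poly_eval scale n X (affine_coroot n i)) * (r i - 1)))
      in if i = 0 then T t0 u0 else if i = n then T tn un else r i)"

definition T_subalgebra ::
    "(complex \<Rightarrow> 'a::ring_1 \<Rightarrow> 'a) \<Rightarrow> nat \<Rightarrow> (nat \<Rightarrow> 'a) \<Rightarrow> (nat \<Rightarrow> 'a)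
      \<Rightarrow> complex \<Rightarrow> complex \<Rightarrow> complex \<Rightarrow> complex \<Rightarrow> 'a set" where
  "T_subalgebra scale n r X t0 u0 tn un =
     is_subalgebra scale hull (T_gen scale n r X t0 u0 tn un ` {0..n})"

definition rational_daha ::
    "(complex \<Rightarrow> 'a::ring_1 \<Rightarrow> 'a) \<Rightarrow> nat \<Rightarrow> (nat \<Rightarrow> 'a) \<Rightarrow> (nat \<Rightarrow> 'a)
      \<Rightarrow> complex \<Rightarrow> complex \<Rightarrow> complex \<Rightarrow> complex \<Rightarrow> 'a set" where
  "rational_daha scale n r X t0 u0 tn un =
     is_subalgebra scale hull (T_subalgebra scale n r X t0 u0 tn un \<union> X ` {1..n})"

text \<open>Indexed by words rather than group elements: the elements \<open>T\<^sub>i\<close> satisfy the braid relations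
  of length four only up to shorter terms, so the product may depend on the reduced
  expression.\<close>
definition T_word ::
    "(complex \<Rightarrow> 'a::ring_1 \<Rightarrow> 'a) \<Rightarrow> nat \<Rightarrow> (nat \<Rightarrow> 'a) \<Rightarrow> (nat \<Rightarrow> 'a)
      \<Rightarrow> complex \<Rightarrow> complex \<Rightarrow> complex \<Rightarrow> complex \<Rightarrow> nat list \<Rightarrow> 'a" where
  "T_word scale n r X t0 u0 tn un u = prod_list (map (T_gen scale n r X t0 u0 tn un) u)"

definition weight_lattice :: "nat \<Rightarrow> (nat \<Rightarrow> int) set" where
  "weight_lattice n = {1..n} \<rightarrow>\<^sub>E UNIV"

definition phi :: "int \<Rightarrow> nat" where
  "phi m = (if m \<ge> 0 then nat (2 * m) else nat (- 2 * m - 1))"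


section \<open>Well-definedness of the action and of the cross-relations\<close>

lemma cpoly_induct:
  fixes p :: cpoly
  assumes "P 0" "\<And>p m c. P p \<Longrightarrow> P (p + Poly_Mapping.single m c)"
  shows "P p"
proof (induction p rule: update_induct)
  case const
  show ?case using assms(1) unfolding zero_poly_mapping_def .
next
  case (update f a b)
  have "Poly_Mapping.update a b f = f + Poly_Mapping.single a b"
    using update by (intro poly_mapping_eqI)
      (auto simp: lookup_update lookup_add lookup_single when_def in_keys_iff)
  then show ?case using assms(2) update by metis
qed

lemma poly_eval_superset:
  assumes "\<And>v. scale 0 v = 0" "finite S" "Poly_Mapping.keys p \<subseteq> S"
  shows "poly_eval scale n X p = (\<Sum>m\<in>S. scale (Poly_Mapping.lookup p m)
           (monomial n X (Poly_Mapping.lookup m)))"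
  unfolding poly_eval_def
  by (rule sum.mono_neutral_left) (use assms in \<open>auto simp: in_keys_iff\<close>)

lemma poly_eval_add:
  assumes "\<And>v. scale 0 v = 0" "\<And>a b v. scale (a + b) v = scale a v + scale b v"
  shows "poly_eval scale n X (p + q) = poly_eval scale n X p + poly_eval scale n X q"
proof -
  let ?S = "Poly_Mapping.keys p \<union> Poly_Mapping.keys q"
  have "Poly_Mapping.keys (p + q) \<subseteq> ?S" by (rule keys_add)
  then show ?thesis
    by (simp add: poly_eval_superset[of scale ?S] assms lookup_add sum.distrib)
qed

lemma poly_eval_single:
  assumes "\<And>v. scale 0 v = 0"
  shows "poly_eval scale n X (Poly_Mapping.single m c)
           = scale c (monomial n X (Poly_Mapping.lookup m))"
  using assms by (simp add: poly_eval_def)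

lemma monomial_add:
  fixes X :: "nat \<Rightarrow> 'a::comm_ring_1"
  shows "monomial n X (Poly_Mapping.lookup (a + b))
           = monomial n X (Poly_Mapping.lookup a) * monomial n X (Poly_Mapping.lookup b)"
proof -
  have "prod_list (map (\<lambda>j. X j ^ Poly_Mapping.lookup (a + b) j) js)
      = prod_list (map (\<lambda>j. X j ^ Poly_Mapping.lookup a j) js)
        * prod_list (map (\<lambda>j. X j ^ Poly_Mapping.lookup b j) js)" for js
    by (induction js) (simp_all add: lookup_add power_add mult_ac)
  then show ?thesis unfolding monomial_def .
qed

context
  fixes n :: nat and x :: "nat \<Rightarrow> complex" and E :: "cpoly \<Rightarrow> complex"
  defines "E \<equiv> poly_eval (*) n x"
begin

lemma E_add: "E (p + q) = E p + E q"
  unfolding E_def by (rule poly_eval_add) (simp_all add: algebra_simps)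

lemma E_single: "E (Poly_Mapping.single m c) = c * monomial n x (Poly_Mapping.lookup m)"
  unfolding E_def by (rule poly_eval_single) simp

lemma E_0: "E 0 = 0"
  by (simp add: E_def poly_eval_def)

lemma E_minus: "E (p - q) = E p - E q"
  using E_add[of "p - q" q] by simp

lemma E_mult_single:
  "E (p * Poly_Mapping.single m c) = E p * E (Poly_Mapping.single m c)"
  by (induction p rule: cpoly_induct)
     (simp_all add: E_0 distrib_right E_add mult_single, simp add: E_single monomial_add)

lemma E_mult: "E (p * q) = E p * E q"
  by (induction q rule: cpoly_induct) (simp_all add: E_0 distrib_left E_add E_mult_single)

lemma E_Const: "E (Const c) = c"
proof -
  have "prod_list (map (\<lambda>j. x j ^ Poly_Mapping.lookup 0 j) js) = 1" for js
    by (induction js) auto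
  then show ?thesis by (simp add: Const_def E_single monomial_def)
qed

lemma E_1: "E 1 = 1"
  using E_Const[of 1] by (simp add: Const_def)

lemma E_Var:
  assumes "j \<in> {1..n}"
  shows "E (Var j) = x j"
proof -
  have "prod_list (map (\<lambda>i. x i ^ Poly_Mapping.lookup (Poly_Mapping.single j 1) i) js)
      = (if j \<in> set js then x j else 1)" if "distinct js" for js
    using that by (induction js) (auto simp: lookup_single when_def)
  then show ?thesis using assms
    by (simp add: Var_def E_single monomial_def del: upt_Suc)
qed

lemma E_power: "E (p ^ e) = E p ^ e"
  by (induction e) (simp_all add: E_1 E_mult)

lemma E_sum: "E (sum f S) = (\<Sum>i\<in>S. E (f i))"
  by (induction S rule: infinite_finite_induct) (simp_all add: E_0 E_add)

lemma E_monomial: "E (monomial n Y \<mu>) = monomial n (\<lambda>j. E (Y j)) \<mu>"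
proof -
  have "E (prod_list (map (\<lambda>j. Y j ^ \<mu> j) js)) = prod_list (map (\<lambda>j. E (Y j) ^ \<mu> j) js)" for js
    by (induction js) (simp_all add: E_1 E_mult E_power)
  then show ?thesis unfolding monomial_def .
qed

lemma poly_eval_act_aux:
  assumes "1 \<le> n" "i \<in> {0..n}"
  shows "E (act n i p) = poly_eval (*) n (reflect n i x) p"
proof -
  have *: "E (reflect n i Var j) = reflect n i x j" if "j \<in> {1..n}" for j
    using that assms E_minus[of 0] by (auto simp: reflect_def E_minus E_1 E_0 E_Var)
  have "monomial n (\<lambda>j. E (reflect n i Var j)) \<mu> = monomial n (reflect n i x) \<mu>" for \<mu>
    unfolding monomial_def
    by (intro arg_cong[where f = prod_list] map_cong) (auto simp: * simp del: upt_Suc)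
  then show ?thesis
    by (simp add: act_def poly_eval_def E_sum E_mult E_Const E_monomial)
qed

lemma E_affine_root:
  assumes "1 \<le> n" "i \<in> {0..n}"
  shows "E (affine_root n i) =
     (if i = 0 then 1 - 2 * x 1 else if i = n then 2 * x n else x i - x (i+1))"
proof -
  have "E (2 * p) = 2 * E p" for p
    using E_add[of p p] by (simp flip: mult_2)
  with assms show ?thesis
    by (auto simp: affine_root_def E_minus E_1 E_Var)
qed

end

lemma poly_eval_act:
  fixes x :: "nat \<Rightarrow> complex"
  assumes "1 \<le> n" "i \<in> {0..n}"
  shows "poly_eval (*) n x (act n i p) = poly_eval (*) n (reflect n i x) p"
  by (rule poly_eval_act_aux[OF assms])

lemma affine_root_nonzero:
  assumes "1 \<le> n" "i \<in> {0..n}"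
  shows "affine_root n i \<noteq> 0"
proof
  assume "affine_root n i = 0"
  with E_affine_root[OF assms, of of_nat] assms E_0[of n of_nat] show False
    by (auto split: if_splits)
qed

lemma polys_0 [simp]: "0 \<in> polys n"
  and polys_1 [simp]: "1 \<in> polys n"
  and polys_Const [simp]: "Const c \<in> polys n"
  by (auto simp: polys_def Const_def simp flip: single_one)

lemma polys_Var: "j \<in> {1..n} \<Longrightarrow> Var j \<in> polys n"
  by (auto simp: polys_def Var_def)

lemma polys_add: "p \<in> polys n \<Longrightarrow> q \<in> polys n \<Longrightarrow> p + q \<in> polys n"
  using keys_add[of p q] by (fastforce simp: polys_def)

lemma polys_uminus: "p \<in> polys n \<Longrightarrow> - p \<in> polys n"
  by (simp add: polys_def)

lemma polys_diff: "p \<in> polys n \<Longrightarrow> q \<in> polys n \<Longrightarrow> p - q \<in> polys n"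
  using polys_add[of p n "- q"] polys_uminus by simp

lemma polys_mult:
  assumes "p \<in> polys n" "q \<in> polys n"
  shows "p * q \<in> polys n"
  unfolding polys_def
proof safe
  fix m j assume "m \<in> Poly_Mapping.keys (p * q)" and j: "j \<in> Poly_Mapping.keys m"
  then obtain a b where "m = a + b" "a \<in> Poly_Mapping.keys p" "b \<in> Poly_Mapping.keys q"
    using keys_mult[of p q] by auto
  then show "j \<in> {1..n}" using j keys_add[of a b] assms by (fastforce simp: polys_def)
qed

lemma polys_power: "p \<in> polys n \<Longrightarrow> p ^ e \<in> polys n"
  by (induction e) (simp_all add: polys_mult)

lemma poly_eval_Var:
  assumes "p \<in> polys n"
  shows "poly_eval (\<lambda>c q. Const c * q) n Var p = p"
proof -
  have mono: "monomial n Var (Poly_Mapping.lookup m) = Poly_Mapping.single m 1"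
    if "Poly_Mapping.keys m \<subseteq> {1..n}" for m
  proof -
    have pow: "Var j ^ e = Poly_Mapping.single (Poly_Mapping.single j e) 1" for j e
      by (induction e) (simp_all add: Var_def mult_single flip: single_add)
    have "prod_list (map (\<lambda>j. Var j ^ Poly_Mapping.lookup m j) js)
        = Poly_Mapping.single (\<Sum>j\<leftarrow>js. Poly_Mapping.single j (Poly_Mapping.lookup m j)) 1" for js
      by (induction js) (simp_all add: pow mult_single)
    moreover have "(\<Sum>j\<leftarrow>[1..<Suc n]. Poly_Mapping.single j (Poly_Mapping.lookup m j)) = m"
    proof (rule poly_mapping_eqI)
      fix i
      have "Poly_Mapping.lookup (\<Sum>j\<leftarrow>js. Poly_Mapping.single j (Poly_Mapping.lookup m j)) i
          = (if i \<in> set js then Poly_Mapping.lookup m i else 0)" if "distinct js" for js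
        using that by (induction js) (auto simp: lookup_add lookup_single when_def)
      then show "Poly_Mapping.lookup
            (\<Sum>j\<leftarrow>[1..<Suc n]. Poly_Mapping.single j (Poly_Mapping.lookup m j)) i
          = Poly_Mapping.lookup m i"
        using that by (auto simp: in_keys_iff simp del: upt_Suc)
    qed
    ultimately show ?thesis by (simp add: monomial_def)
  qed
  have "poly_eval (\<lambda>c q. Const c * q) n Var p
      = (\<Sum>m\<in>Poly_Mapping.keys p. Poly_Mapping.single m (Poly_Mapping.lookup p m))"
    unfolding poly_eval_def
    by (rule sum.cong) (use assms in \<open>auto simp: mono polys_def Const_def mult_single\<close>)
  also have "\<dots> = p"
    by (rule poly_mapping_eqI)
       (simp add: lookup_sum lookup_single when_def in_keys_iff)
  finally show ?thesis .
qed

lemma ex1_quotient: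
  assumes "1 \<le> n" "i \<in> {0..n}" "p \<in> polys n"
  shows "\<exists>!q. q \<in> polys n \<and> affine_root n i * q = act n i p - p"
proof -
  define D where "D = {f. \<exists>q\<in>polys n. f = affine_root n i * q}"
  have D0: "0 \<in> D"
    unfolding D_def by (auto intro!: bexI[of _ 0])
  have D_add: "f + g \<in> D" if "f \<in> D" "g \<in> D" for f g
    using that unfolding D_def by (auto simp flip: distrib_left intro: polys_add)
  have D_mult: "f * g \<in> D" if "f \<in> D" "g \<in> polys n" for f g
    using that unfolding D_def by (auto simp: mult.assoc intro: polys_mult)
  have D_prod: "a * b - c * d \<in> D"
    if "a - c \<in> D" "b - d \<in> D" "b \<in> polys n" "c \<in> polys n" for a b c d
  proof -
    have "a * b - c * d = (a - c) * b + (b - d) * c" by (simp add: algebra_simps)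
    then show ?thesis using that D_add D_mult by metis
  qed
  let ?Y = "reflect n i Var"
  have Y: "?Y j \<in> polys n" if "j \<in> {1..n}" for j
    using that assms by (auto simp: reflect_def intro!: polys_Var polys_diff polys_uminus)
  have DY: "?Y j - Var j \<in> D" if "j \<in> {1..n}" for j
  proof -
    have "?Y j - Var j \<in> {0, affine_root n i, - affine_root n i}"
      using that assms by (auto simp: reflect_def affine_root_def)
    moreover have "affine_root n i \<in> D"
      unfolding D_def by (auto intro!: bexI[of _ 1])
    moreover have "- affine_root n i \<in> D"
      unfolding D_def by (auto intro!: bexI[of _ "-1"] polys_uminus)
    ultimately show ?thesis using D0 by auto
  qed
  have Dpow: "?Y j ^ e - Var j ^ e \<in> D" if "j \<in> {1..n}" for j e
    using that
    by (induction e) (auto simp: D0 intro!: D_prod DY Y polys_Var polys_power)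
  have Dlist: "prod_list (map (\<lambda>j. ?Y j ^ \<mu> j) js) - prod_list (map (\<lambda>j. Var j ^ \<mu> j) js) \<in> D
      \<and> prod_list (map (\<lambda>j. ?Y j ^ \<mu> j) js) \<in> polys n"
    if "set js \<subseteq> {1..n}" for js \<mu>
    using that
  proof (induction js)
    case (Cons j js)
    then have "j \<in> {1..n}" by simp
    with Cons show ?case
      by (auto intro!: D_prod Dpow polys_mult polys_power Y polys_Var)
  qed (auto simp: D0)
  have "act n i p - p = (\<Sum>m\<in>Poly_Mapping.keys p.
      (monomial n ?Y (Poly_Mapping.lookup m) - monomial n Var (Poly_Mapping.lookup m))
        * Const (Poly_Mapping.lookup p m))"
    by (subst (2) poly_eval_Var[OF assms(3), symmetric])
       (simp add: act_def poly_eval_def algebra_simps flip: sum_subtractf)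
  moreover have "sum f S \<in> D" if "\<And>m. f m \<in> D" for f :: "(nat \<Rightarrow>\<^sub>0 nat) \<Rightarrow> cpoly" and S
    using that by (induction S rule: infinite_finite_induct) (auto simp: D0 D_add)
  moreover have "monomial n ?Y \<mu> - monomial n Var \<mu> \<in> D" for \<mu>
    unfolding monomial_def by (rule conjunct1[OF Dlist]) auto
  ultimately have "act n i p - p \<in> D"
    using D_mult by simp
  then have "\<exists>q. q \<in> polys n \<and> affine_root n i * q = act n i p - p"
    unfolding D_def by auto
  moreover have "q = q'" if "affine_root n i * q = affine_root n i * q'" for q q'
    using that affine_root_nonzero[OF assms(1,2)] by simp
  ultimately show ?thesis by metis
qed

end

theory Submission
  imports Defs
begin

text \<open>
  Each \<open>T\<^sub>i\<close> has the form \<open>\<tau>(X) r\<^sub>i + \<sigma>(X)\<close> with \<open>\<tau> \<noteq> 0\<close>, so \<open>T\<^bsub>w\<^esub>\<close> equals \<open>r\<^bsub>w\<^esub>\<close> times a nonzero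
  polynomial up to terms of smaller length; moving polynomials past \<open>r\<^bsub>w\<^esub>\<close> only twists them, and
  independence follows from the triangular shape with respect to the basis of \<open>\<complex>[W] \<otimes> \<complex>[X]\<close>.
  For the spanning property, \<open>T\<^sub>i\<^sup>2\<close> is a scalar and the \<open>T\<^sub>i\<close> satisfy the braid relations up to
  shorter words (\<open>A s A s - s A s A\<close> is a multiple of \<open>s A - A s\<close>). By the exchange property and
  Matsumoto's theorem every word in the \<open>T\<^sub>i\<close> is then a combination of the \<open>T\<^bsub>w\<^esub>\<close>, and
  \<open>T\<^sub>i p - (s\<^sub>i p) T\<^sub>i\<close> is a polynomial, so both spans are stable under left multiplication
  by the generators.\<close>

section \<open>Reduced words\<close>

text \<open>The leading coefficients at the two ends are nonconstant polynomials, hence not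
  invertible. So triangularity gives independence but cannot give spanning, which has to come from
  relations among the \<open>T i\<close> alone. These relations hold only up to shorter words, and a
  second reduced expression of \<open>w\<close> may give a different product; Matsumoto's theorem is
  needed to compare the two by braid moves, whose errors can be controlled. The group is known only
  by its presentation, so exchange must be obtained from words. The algebra supplies a faithful copy
  of it: in \<complex>[W] \<otimes> \<complex>[X] different group elements are different basis
  vectors, so two words are equivalent iff their products of the \<open>r i\<close> agree. Exchange
  then follows from the classical parity count of the reflections met along a word, and the action
  on points serves to tell short alternating words apart.\<close>

definition braid_relations :: "nat \<Rightarrow> (nat list \<times> nat list) set" where
  "braid_relations n = {(l, l') \<in> coxeter_relations n. l' \<noteq> []}"

inductive braid_equiv :: "nat \<Rightarrow> nat list \<Rightarrow> nat list \<Rightarrow> bool" for n where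
  refl: "set u \<subseteq> {0..n} \<Longrightarrow> braid_equiv n u u"
| sym: "braid_equiv n u v \<Longrightarrow> braid_equiv n v u"
| trans: "braid_equiv n u v \<Longrightarrow> braid_equiv n v w \<Longrightarrow> braid_equiv n u w"
| step: "set u \<subseteq> {0..n} \<Longrightarrow> set v \<subseteq> {0..n} \<Longrightarrow> (l, l') \<in> braid_relations n
         \<Longrightarrow> braid_equiv n (u @ l @ v) (u @ l' @ v)"

definition reduced_word :: "nat \<Rightarrow> nat list \<Rightarrow> bool" where
  "reduced_word n u \<longleftrightarrow> set u \<subseteq> {0..n} \<and> (\<forall>v. coxeter_equiv n u v \<longrightarrow> length u \<le> length v)"

lemma coxeter_relations_set:
  assumes "n \<ge> 1" "(l, l') \<in> coxeter_relations n"
  shows "set l \<subseteq> {0..n} \<and> set l' \<subseteq> {0..n}"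
  using assms by (auto simp: coxeter_relations_def)

lemma braid_relations_length:
  assumes "(l, l') \<in> braid_relations n"
  shows "length l = length l'"
  using assms by (auto simp: braid_relations_def coxeter_relations_def)

lemma coxeter_equiv_set:
  assumes "coxeter_equiv n u v" "n \<ge> 1"
  shows "set u \<subseteq> {0..n} \<and> set v \<subseteq> {0..n}"
  using assms(1)
proof (induction rule: coxeter_equiv.induct)
  case (step u v l l')
  then show ?case using coxeter_relations_set[OF assms(2) step(3)] by auto
qed auto

lemma coxeter_equiv_even_length:
  assumes "coxeter_equiv n u v"
  shows "even (length u) \<longleftrightarrow> even (length v)"
  using assms
proof (induction rule: coxeter_equiv.induct)
  case (step u v l l')
  then have "even (length l) \<longleftrightarrow> even (length l')"
    by (auto simp: coxeter_relations_def)
  then show ?case by simp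
qed auto

lemma coxeter_equiv_Cons:
  assumes "coxeter_equiv n u v" "i \<in> {0..n}"
  shows "coxeter_equiv n (i # u) (i # v)"
  using assms(1)
proof (induction rule: coxeter_equiv.induct)
  case (step u v l l')
  then show ?case
    using coxeter_equiv.step[of "i # u" n v l l'] assms(2) by auto
qed (use assms(2) in \<open>auto intro: coxeter_equiv.sym coxeter_equiv.trans intro!: coxeter_equiv.refl\<close>)

lemma braid_equiv_Cons:
  assumes "braid_equiv n u v" "i \<in> {0..n}"
  shows "braid_equiv n (i # u) (i # v)"
  using assms(1)
proof (induction rule: braid_equiv.induct)
  case (step u v l l')
  then show ?case
    using braid_equiv.step[of "i # u" n v l l'] assms(2) by auto
qed (use assms(2) in \<open>auto intro: braid_equiv.sym braid_equiv.trans intro!: braid_equiv.refl\<close>)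

lemma braid_equiv_length:
  assumes "braid_equiv n u v"
  shows "length u = length v"
  using assms
  by (induction rule: braid_equiv.induct) (auto dest: braid_relations_length)

lemma braid_equiv_set:
  assumes "braid_equiv n u v" "n \<ge> 1"
  shows "set u \<subseteq> {0..n} \<and> set v \<subseteq> {0..n}"
  using assms(1)
proof (induction rule: braid_equiv.induct)
  case (step u v l l')
  then show ?case
    using coxeter_relations_set[OF assms(2), of l l'] by (auto simp: braid_relations_def)
qed auto

section \<open>Separating short words by their action on integer points\<close>

lemma reflect_coxeter_equiv:
  fixes x :: "nat \<Rightarrow> int"
  assumes "coxeter_equiv n u v" "n \<ge> 2"
  shows "foldr (reflect n) u x = foldr (reflect n) v x"
  using assms(1)
proof (induction arbitrary: x rule: coxeter_equiv.induct)
  case (step u v l l')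
  have "foldr (reflect n) l y = foldr (reflect n) l' y" for y :: "nat \<Rightarrow> int"
    using step(3) assms(2)
    by (fastforce simp: coxeter_relations_def reflect_def fun_eq_iff)
  then show ?case by simp
qed auto

lemma not_coxeter_equiv:
  assumes "n \<ge> 2"
  shows "i \<in> {0..n} \<Longrightarrow> j \<in> {0..n} \<Longrightarrow> i \<noteq> j \<Longrightarrow> \<not> coxeter_equiv n [i] [j]"
    and "i < n \<Longrightarrow> \<not> coxeter_equiv n [i, i+1] [i+1, i]"
    and "i \<in> {0, n-1} \<Longrightarrow> \<not> coxeter_equiv n [i, i+1, i] [i+1, i, i+1]"
proof -
  \<comment> \<open>All entries are distinct and at least 2, so they also differ from every
    \<open>- x k\<close> and every \<open>1 - x k\<close>. The coordinate \<open>k\<close> named in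
    each case below separates the two words.\<close>
  define x :: "nat \<Rightarrow> int" where "x = (\<lambda>k. int k + 2)"
  have *: "\<not> coxeter_equiv n u v" if "foldr (reflect n) u x k \<noteq> foldr (reflect n) v x k" for u v k
    using reflect_coxeter_equiv[OF _ assms] that by metis
  show "\<not> coxeter_equiv n [i] [j]" if "i \<in> {0..n}" "j \<in> {0..n}" "i \<noteq> j"
  proof -
    have **: "\<not> coxeter_equiv n [i] [j]" if "i < j" "j \<le> n" for i j
    proof (cases "i = 0")
      case True
      show ?thesis
        by (rule *[where k = 1]) (use that assms True in \<open>auto simp: reflect_def x_def\<close>)
    next
      case False
      show ?thesis
        by (rule *[where k = i]) (use that assms False in \<open>auto simp: reflect_def x_def\<close>)
    qed
    show ?thesis using **[of i j] **[of j i] that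
      by (cases "i < j") (auto intro: coxeter_equiv.sym)
  qed
  show "\<not> coxeter_equiv n [i, i+1] [i+1, i]" if "i < n"
    by (rule *[where k = "if i = 0 then 1 else i"])
      (use that assms in \<open>auto simp: reflect_def x_def\<close>)
  show "\<not> coxeter_equiv n [i, i+1, i] [i+1, i, i+1]" if "i \<in> {0, n-1}"
    by (rule *[where k = "i + 1"]) (use that assms in \<open>auto simp: reflect_def x_def\<close>)
qed

text \<open>A faithful copy of the group inside a monoid. Word equivalence becomes equality of
  products, so arguments about classes turn into computations with the involutions
  \<open>r i\<close>, and \<open>R (rev u)\<close> is the inverse of \<open>R u\<close>.\<close>

locale coxeter_realization =
  fixes n :: nat and r :: "nat \<Rightarrow> 'a::monoid_mult"
  assumes n2: "2 \<le> n"
    and realize: "set u \<subseteq> {0..n} \<Longrightarrow> set v \<subseteq> {0..n} \<Longrightarrow>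
      coxeter_equiv n u v \<longleftrightarrow> prod_list (map r u) = prod_list (map r v)"
begin

abbreviation "R u \<equiv> prod_list (map r u)"

lemma relation: "(l, l') \<in> coxeter_relations n \<Longrightarrow> R l = R l'"
  using coxeter_equiv.step[of "[]" n "[]" l l'] coxeter_relations_set[of n l l'] n2
  by (subst realize[symmetric]) auto

lemma r_square: "i \<in> {0..n} \<Longrightarrow> r i * r i = 1"
  using relation[of "[i, i]" "[]"] by (auto simp: coxeter_relations_def)

lemma r_cancel: "i \<in> {0..n} \<Longrightarrow> r i * (r i * x) = x"
  by (simp add: r_square flip: mult.assoc)

lemma r_left_cancel: "i \<in> {0..n} \<Longrightarrow> r i * x = r i * y \<longleftrightarrow> x = y"
  by (metis r_cancel)

lemma R_rev: "set u \<subseteq> {0..n} \<Longrightarrow> R (rev u) * R u = 1"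
  by (induction u) (auto simp: mult.assoc r_cancel)

lemma R_rev': "set u \<subseteq> {0..n} \<Longrightarrow> R u * R (rev u) = 1"
  using R_rev[of "rev u"] by simp

lemma R_right_cancel: "set u \<subseteq> {0..n} \<Longrightarrow> x * R u = y * R u \<longleftrightarrow> x = y"
  by (metis R_rev' mult.assoc mult.right_neutral)

lemma conj_eq_iff: "i \<in> {0..n} \<Longrightarrow> r i * x * r i = y \<longleftrightarrow> x = r i * y * r i"
  by (metis mult.assoc mult.right_neutral r_cancel r_square)

text \<open>The parity of the number of factorisations \<open>u = v @ [j] @ w\<close> in which \<open>\<rho>\<close> is the
  reflection \<open>R v * r j * R (rev v)\<close>.\<close>
fun refl_parity :: "nat list \<Rightarrow> 'a \<Rightarrow> bool" where
  "refl_parity [] \<rho> = False"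
| "refl_parity (i # u) \<rho> = ((\<rho> = r i) \<noteq> refl_parity u (r i * \<rho> * r i))"

lemma refl_parity_append:
  "refl_parity (u @ v) \<rho> = (refl_parity u \<rho> \<noteq> refl_parity v (R (rev u) * \<rho> * R u))"
  by (induction u arbitrary: \<rho>) (auto simp: mult.assoc)

text \<open>The word \<open>[i, i]\<close> meets the reflection \<open>r i\<close> twice. The two
  sides of a braid relation meet the same reflections in opposite orders. So no count changes modulo
  2.\<close>

lemma refl_parity_relation:
  assumes "(l, l') \<in> coxeter_relations n"
  shows "refl_parity l \<rho> = refl_parity l' \<rho>"
proof -
  have sq: "refl_parity [i, i] \<rho> = refl_parity [] \<rho>" if "i \<in> {0..n}" for i
    unfolding refl_parity.simps conj_eq_iff[OF that]
    using that by (auto simp: mult.assoc r_square)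
  have br2: "refl_parity [i, j] \<rho> = refl_parity [j, i] \<rho>"
    if "i \<in> {0..n}" "j \<in> {0..n}" "r i * r j = r j * r i" for i j
  proof -
    have "r i * r j * r i = r j" "r j * r i * r j = r i"
      using that by (metis mult.assoc r_cancel)+
    then show ?thesis unfolding refl_parity.simps conj_eq_iff[OF that(1)] conj_eq_iff[OF that(2)]
      by auto
  qed
  have br3: "refl_parity [i, j, i] \<rho> = refl_parity [j, i, j] \<rho>"
    if "i \<in> {0..n}" "j \<in> {0..n}" and e: "r i * r j * r i = r j * r i * r j" for i j
  proof -
    have "r i * (r j * r i * r j) * r i = r j" "r j * (r i * r j * r i) * r j = r i"
      using that by (metis conj_eq_iff)+
    then show ?thesis unfolding refl_parity.simps conj_eq_iff[OF that(1)] conj_eq_iff[OF that(2)]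
      using e by auto
  qed
  have br4: "refl_parity [i, j, i, j] \<rho> = refl_parity [j, i, j, i] \<rho>"
    if "i \<in> {0..n}" "j \<in> {0..n}"
      and e: "r i * r j * r i * r j = r j * r i * r j * r i" for i j
  proof -
    \<comment> \<open>For four letters the third and fourth reflections met are
      \<open>a * (b * a * b) * a\<close> and \<open>a * (b * (a * b * a) * b) * a\<close>; the braid
      relation reduces them to \<open>b * a * b\<close> and \<open>b\<close>.\<close>
    have 5: "a * (b * a * b) * a = b * a * b" "a * (b * (a * b * a) * b) * a = b"
      if "a * b * a * b = b * a * b * a" "a * a = 1" "b * b = 1" for a b :: 'a
    proof -
      have "a * (b * a * b) * a = a * b * a * b * a" by (simp add: mult.assoc)
      also have "\<dots> = b * a * b" unfolding that(1) using that(2) by (simp add: mult.assoc)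
      finally show 1: "a * (b * a * b) * a = b * a * b" .
      have "a * (b * (a * b * a) * b) * a = (a * (b * a * b) * a) * (b * a)"
        by (simp add: mult.assoc)
      also have "\<dots> = b * (a * ((b * b) * a))" unfolding 1 by (simp add: mult.assoc)
      finally show "a * (b * (a * b * a) * b) * a = b" using that by simp
    qed
    show ?thesis
      unfolding refl_parity.simps conj_eq_iff[OF that(1)] conj_eq_iff[OF that(2)]
      using 5[OF e] 5[OF e[symmetric]] that(1,2)[THEN r_square] by auto
  qed
  note rel = relation[OF assms]
  show ?thesis using assms rel n2
    unfolding coxeter_relations_def
    apply (elim UnE)
    subgoal using sq by auto
    subgoal using br4 by (auto simp: mult.assoc simp del: refl_parity.simps)
    subgoal using br3 by (auto simp: mult.assoc simp del: refl_parity.simps)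
    subgoal using br2 by (auto simp del: refl_parity.simps)
    done
qed

lemma refl_parity_equiv:
  assumes "coxeter_equiv n u v"
  shows "refl_parity u \<rho> = refl_parity v \<rho>"
  using assms
proof (induction arbitrary: \<rho> rule: coxeter_equiv.induct)
  case (step u v l l')
  have sets: "set l \<subseteq> {0..n}" "set l' \<subseteq> {0..n}"
    using coxeter_relations_set[OF _ step(3)] n2 by auto
  have "R l = R l'" using relation[OF step(3)] .
  moreover have "R (rev l) = R (rev l')"
    by (metis R_rev R_rev' calculation sets mult.assoc mult.left_neutral mult.right_neutral)
  ultimately show ?case
    by (simp add: refl_parity_append refl_parity_relation[OF step(3)] mult.assoc)
qed auto

text \<open>Odd parity forces at least one occurrence
  \<open>\<rho> = R ys * r y * R (rev ys)\<close>, and multiplying by this reflection on the left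
  cancels the letter \<open>y\<close>.\<close>

lemma refl_parity_delete:
  assumes "set u \<subseteq> {0..n}" "refl_parity u \<rho>"
  shows "\<exists>ys y zs. u = ys @ y # zs \<and> \<rho> * R u = R (ys @ zs)"
  using assms
proof (induction u arbitrary: \<rho>)
  case (Cons j u)
  show ?case
  proof (cases "\<rho> = r j")
    case True
    then show ?thesis using Cons.prems
      by (intro exI[of _ "[]"]) (auto simp: r_cancel)
  next
    case False
    then have "refl_parity u (r j * \<rho> * r j)" using Cons.prems by simp
    then obtain ys y zs where *: "u = ys @ y # zs" "r j * \<rho> * r j * R u = R (ys @ zs)"
      using Cons.IH[of "r j * \<rho> * r j"] Cons.prems by auto
    have "\<rho> * R (j # u) = R ((j # ys) @ zs)"
      using arg_cong[OF *(2), of "\<lambda>z. r j * z"] Cons.prems by (simp add: mult.assoc r_cancel)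
    then show ?thesis using *(1) by (metis append_Cons)
  qed
qed simp

lemma equivI: "set u \<subseteq> {0..n} \<Longrightarrow> set v \<subseteq> {0..n} \<Longrightarrow> R u = R v \<Longrightarrow> coxeter_equiv n u v"
  using realize by simp

lemma reduced_wordD:
  "reduced_word n u \<Longrightarrow> set v \<subseteq> {0..n} \<Longrightarrow> R u = R v \<Longrightarrow> length u \<le> length v"
  by (simp add: reduced_word_def realize)

lemma reduced_wordI:
  assumes "reduced_word n u" "set v \<subseteq> {0..n}" "R u = R v" "length u = length v"
  shows "reduced_word n v"
  unfolding reduced_word_def
proof safe
  show "x \<in> {0..n}" if "x \<in> set v" for x using that assms by auto
  fix w assume w: "coxeter_equiv n v w"
  have "coxeter_equiv n u v" using assms equivI by (auto simp: reduced_word_def)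
  then have "coxeter_equiv n u w" using w coxeter_equiv.trans by blast
  then show "length v \<le> length w" using assms by (auto simp: reduced_word_def)
qed

lemma reduced_word_tail: "reduced_word n (i # u) \<Longrightarrow> reduced_word n u"
  unfolding reduced_word_def using coxeter_equiv_Cons[of n u _ i] by fastforce

lemma ex_reduced_word:
  assumes "set u \<subseteq> {0..n}"
  shows "\<exists>v. reduced_word n v \<and> coxeter_equiv n u v"
proof -
  define v where "v = arg_min length (coxeter_equiv n u)"
  have "coxeter_equiv n u u" using assms by (rule coxeter_equiv.refl)
  then have v: "coxeter_equiv n u v" "\<And>w. coxeter_equiv n u w \<Longrightarrow> length v \<le> length w"
    unfolding v_def by (auto intro: arg_min_natI arg_min_nat_le)
  moreover have "set v \<subseteq> {0..n}" using coxeter_equiv_set[OF v(1)] n2 by auto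
  moreover have "length v \<le> length w" if "coxeter_equiv n v w" for w
    using v that coxeter_equiv.trans by blast
  ultimately show ?thesis unfolding reduced_word_def by blast
qed

text \<open>In \<open>u\<close> the parity of \<open>r i\<close> is even: otherwise deletion would
  give a word for \<open>R (i # u)\<close> with two letters fewer, against reducedness. So it is odd
  in \<open>i # u\<close>, hence also in the equivalent word \<open>v\<close>, and deletion in
  \<open>v\<close> finds the letter that is traded for an initial \<open>i\<close>.\<close>

lemma exchange:
  assumes v: "reduced_word n v" and i: "i \<in> {0..n}" and u: "reduced_word n (i # u)"
    and eq: "R (i # u) = R v"
  obtains ys y zs where "v = ys @ y # zs" "R (i # ys @ zs) = R v" "reduced_word n (i # ys @ zs)"
proof -
  have sets: "set v \<subseteq> {0..n}" "set u \<subseteq> {0..n}" using u v by (auto simp: reduced_word_def)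
  have "\<not> refl_parity u (r i)"
  proof
    assume "refl_parity u (r i)"
    then obtain ys y zs where *: "u = ys @ y # zs" "r i * R u = R (ys @ zs)"
      using refl_parity_delete sets by blast
    then show False using reduced_wordD[OF u, of "ys @ zs"] sets by auto
  qed
  then have par: "refl_parity (i # u) (r i)" using i by (simp add: r_square)
  have "refl_parity v (r i)"
    using refl_parity_equiv[OF equivI[OF _ _ eq], of "r i"] par sets i by (auto simp del: refl_parity.simps)
  then obtain ys y zs where *: "v = ys @ y # zs" "r i * R v = R (ys @ zs)"
    using refl_parity_delete sets by blast
  have "R (i # ys @ zs) = R v" using *(2) i by (metis list.simps(9) prod_list.Cons r_cancel)
  moreover from this have "reduced_word n (i # ys @ zs)"
    using reduced_wordI[OF v, of "i # ys @ zs"] * sets i by auto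
  ultimately show ?thesis using * that by blast
qed

section \<open>Reduced words with prescribed beginning, and Matsumoto's theorem\<close>

definition starts_with :: "nat list \<Rightarrow> 'a \<Rightarrow> bool" where
  "starts_with a x \<longleftrightarrow> (\<exists>u. reduced_word n (a @ u) \<and> R (a @ u) = x)"

text \<open>Exchange in the word beginning with \<open>j\<close> puts \<open>i\<close> in front and
  removes one letter. Were this the leading \<open>j\<close>, cancelling the common tail would give
  \<open>r i = r j\<close>. The lemmas \<open>starts_with_3\<close> and \<open>starts_with_4\<close>
  iterate this on a word that begins with two or three alternating letters \<open>j, i, ...\<close>:
  removing one of these would contradict an assumed inequality.\<close>

lemma starts_with_2:
  assumes "starts_with [i] x" "starts_with [j] x" "r i \<noteq> r j"
  shows "starts_with [i, j] x"
proof -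
  obtain u v where uv: "reduced_word n (i # u)" "R (i # u) = x" "reduced_word n (j # v)" "R (j # v) = x"
    using assms by (auto simp: starts_with_def)
  then have sets: "i \<in> {0..n}" "j \<in> {0..n}" "set v \<subseteq> {0..n}" by (auto simp: reduced_word_def)
  obtain ys y zs where *: "j # v = ys @ y # zs" "R (i # ys @ zs) = R (j # v)"
      "reduced_word n (i # ys @ zs)"
    using exchange[OF uv(3) sets(1) uv(1)] uv by auto
  have zs: "set zs \<subseteq> {0..n}" using arg_cong[OF *(1), of set] sets by auto
  show ?thesis
  proof (cases ys)
    case Nil
    then have "r i * R zs = r j * R zs" using * by (auto simp: mult.assoc)
    then show ?thesis using assms R_right_cancel[OF zs] by blast
  next
    case (Cons a ys')
    then show ?thesis using * uv unfolding starts_with_def by (intro exI[of _ "ys' @ zs"]) auto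
  qed
qed

lemma starts_with_3:
  assumes "starts_with [i] x" "starts_with [j] x" "r i \<noteq> r j" "r i * r j \<noteq> r j * r i"
  shows "starts_with [i, j, i] x"
proof -
  obtain u v where uv: "reduced_word n (i # u)" "R (i # u) = x"
      "reduced_word n (j # i # v)" "R (j # i # v) = x"
    using assms(1) starts_with_2[of j x i] assms by (auto simp: starts_with_def)
  then have sets: "i \<in> {0..n}" "j \<in> {0..n}" "set v \<subseteq> {0..n}" by (auto simp: reduced_word_def)
  obtain ys y zs where *: "j # i # v = ys @ y # zs" "R (i # ys @ zs) = R (j # i # v)"
      "reduced_word n (i # ys @ zs)"
    using exchange[OF uv(3) sets(1) uv(1)] uv by auto
  have zs: "set zs \<subseteq> {0..n}" using arg_cong[OF *(1), of set] sets by auto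
  consider "ys = []" | "ys = [j]" | ys' where "ys = j # i # ys'"
    using *(1) by (auto simp: Cons_eq_append_conv)
  then show ?thesis
  proof cases
    case 1
    then have "r i * R zs = r j * R zs" using * by (auto simp: mult.assoc)
    then show ?thesis using assms R_right_cancel[OF zs] by blast
  next
    case 2
    then have "r i * r j * R zs = r j * r i * R zs" using * by (auto simp: mult.assoc)
    then show ?thesis using assms R_right_cancel[OF zs] by blast
  next
    case 3
    then show ?thesis using * uv unfolding starts_with_def by (intro exI[of _ "ys' @ zs"]) auto
  qed
qed

lemma starts_with_4:
  assumes "starts_with [i] x" "starts_with [j] x" "r i \<noteq> r j" "r i * r j \<noteq> r j * r i"
    and "r i * r j * r i \<noteq> r j * r i * r j"
  shows "starts_with [i, j, i, j] x"
proof -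
  obtain u v where uv: "reduced_word n (i # u)" "R (i # u) = x"
      "reduced_word n (j # i # j # v)" "R (j # i # j # v) = x"
    using assms(1) starts_with_3[of j x i] assms by (auto simp: starts_with_def)
  then have sets: "i \<in> {0..n}" "j \<in> {0..n}" "set v \<subseteq> {0..n}" by (auto simp: reduced_word_def)
  obtain ys y zs where *: "j # i # j # v = ys @ y # zs" "R (i # ys @ zs) = R (j # i # j # v)"
      "reduced_word n (i # ys @ zs)"
    using exchange[OF uv(3) sets(1) uv(1)] uv by auto
  have zs: "set zs \<subseteq> {0..n}" using arg_cong[OF *(1), of set] sets by auto
  consider "ys = []" | "ys = [j]" | "ys = [j, i]" | ys' where "ys = j # i # j # ys'"
    using *(1) by (auto simp: Cons_eq_append_conv)
  then show ?thesis
  proof cases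
    case 1
    then have "r i * R zs = r j * R zs" using * by (auto simp: mult.assoc)
    then show ?thesis using assms R_right_cancel[OF zs] by blast
  next
    case 2
    then have "r i * r j * R zs = r j * r i * R zs" using * by (auto simp: mult.assoc)
    then show ?thesis using assms R_right_cancel[OF zs] by blast
  next
    case 3
    then have "r i * r j * r i * R zs = r j * r i * r j * R zs" using * by (auto simp: mult.assoc)
    then show ?thesis using assms R_right_cancel[OF zs] by blast
  next
    case 4
    then show ?thesis using * uv unfolding starts_with_def by (intro exI[of _ "ys' @ zs"]) auto
  qed
qed

text \<open>The exchange steps need alternating words shorter than the braid relation of the pair to
  be distinct; \<open>not_coxeter_equiv\<close> provides exactly this, and faithfulness carries it
  over to the \<open>r i\<close>.\<close>

lemma starts_with_braid:
  assumes "starts_with [i] x" "starts_with [j] x" "i \<noteq> j"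
  shows "\<exists>a b. ((i # a, j # b) \<in> braid_relations n \<or> (j # b, i # a) \<in> braid_relations n)
     \<and> starts_with (i # a) x"
proof -
  have ij: "i \<in> {0..n}" "j \<in> {0..n}"
    using assms by (auto simp: starts_with_def reduced_word_def)
  have ne: "r i \<noteq> r j"
    using not_coxeter_equiv(1)[OF n2 ij assms(3)] realize[of "[i]" "[j]"] ij by auto
  have comm: "r a * r b \<noteq> r b * r a" if "b = a + 1" "b \<le> n" for a b
    using not_coxeter_equiv(2)[OF n2, of a] realize[of "[a, b]" "[b, a]"] that by auto
  have braid: "r a * r b * r a \<noteq> r b * r a * r b" if "b = a + 1" "b \<le> n" "a \<in> {0, n-1}" for a b
    using not_coxeter_equiv(3)[OF n2, of a] realize[of "[a, b, a]" "[b, a, b]"] that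
    by (auto simp: mult.assoc)
  note rel = braid_relations_def coxeter_relations_def
  consider "i + 2 \<le> j \<or> j + 2 \<le> i" | "j = i + 1" | "i = j + 1"
    using assms(3) by linarith
  then show ?thesis
  proof cases
    case 1
    then show ?thesis using starts_with_2[OF assms(1,2) ne] ij
      by (intro exI[of _ "[j]"] exI[of _ "[i]"]) (auto simp: rel)
  next
    case 2
    show ?thesis
    proof (cases "i \<in> {0, n-1}")
      case True
      then show ?thesis
        using starts_with_4[OF assms(1,2) ne comm[of j i] braid[of j i]] ij 2
        by (intro exI[of _ "[j, i, j]"] exI[of _ "[i, j, i]"]) (auto simp: rel)
    next
      case False
      then have "i \<in> {1..n-2}" using ij 2 n2 by auto
      then show ?thesis
        using starts_with_3[OF assms(1,2) ne comm[of j i]] ij 2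
        by (intro exI[of _ "[j, i]"] exI[of _ "[i, j]"]) (auto simp: rel)
    qed
  next
    case 3
    show ?thesis
    proof (cases "j \<in> {0, n-1}")
      case True
      then show ?thesis
        using starts_with_4[OF assms(1,2) ne comm[of i j, symmetric] braid[of i j, symmetric]] ij 3
        by (intro exI[of _ "[j, i, j]"] exI[of _ "[i, j, i]"]) (auto simp: rel)
    next
      case False
      then have "j \<in> {1..n-2}" using ij 3 n2 by auto
      then show ?thesis
        using starts_with_3[OF assms(1,2) ne comm[of i j, symmetric]] ij 3
        by (intro exI[of _ "[j, i]"] exI[of _ "[i, j]"]) (auto simp: rel)
    qed
  qed
qed

text \<open>Equal first letters cancel. If they differ, some reduced word begins with the braid word
  of \<open>i\<close> and \<open>j\<close>. It shares its first letter with \<open>u\<close>, and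
  after one braid move with \<open>v\<close>, so the induction hypothesis applies to both pairs of
  tails.\<close>

theorem matsumoto:
  assumes "reduced_word n u" "reduced_word n v" "R u = R v"
  shows "braid_equiv n u v"
  using assms
proof (induction "length u" arbitrary: u v)
  case 0
  then have "length v \<le> length u" using reduced_wordD[of v u] by (auto simp: reduced_word_def)
  then show ?case using 0 by (auto intro: braid_equiv.refl)
next
  case (Suc m)
  have tail: "braid_equiv n (i # x) (i # y)"
    if "reduced_word n (i # x)" "reduced_word n (i # y)" "R (i # x) = R (i # y)" "length x = m"
    for i x y
  proof -
    have i: "i \<in> {0..n}" using that by (auto simp: reduced_word_def)
    then have "R x = R y" using that by (simp add: r_left_cancel)
    then show ?thesis
      using Suc.hyps(1)[of x y] that i braid_equiv_Cons[of n x y i] by (auto dest: reduced_word_tail)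
  qed
  have sets: "set u \<subseteq> {0..n}" "set v \<subseteq> {0..n}" using Suc.prems by (auto simp: reduced_word_def)
  have len: "length u = length v"
    using reduced_wordD[of u v] reduced_wordD[of v u] Suc.prems sets by force
  obtain i u' j v' where uv: "u = i # u'" "v = j # v'"
    using Suc.hyps(2) len by (metis length_Suc_conv)
  have lens: "length u' = m" "length v' = m" using uv Suc.hyps(2) len by auto
  show ?case
  proof (cases "i = j")
    case True
    then show ?thesis using tail uv lens Suc.prems by auto
  next
    case False
    have "starts_with [i] (R u)" "starts_with [j] (R u)"
      using uv Suc.prems by (auto simp: starts_with_def)
    from starts_with_braid[OF this False] obtain a b x where
      rel: "(i # a, j # b) \<in> braid_relations n \<or> (j # b, i # a) \<in> braid_relations n"
      and x: "reduced_word n (i # a @ x)" "R (i # a @ x) = R u"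
      by (auto simp: starts_with_def)
    have x_set: "set (i # a @ x) \<subseteq> {0..n}" using x by (auto simp: reduced_word_def)
    have step: "braid_equiv n ((i # a) @ x) ((j # b) @ x)"
      using rel braid_equiv.step[of "[]" n x "i # a" "j # b"] x_set
        braid_equiv.step[of "[]" n x "j # b" "i # a"] braid_equiv.sym by auto
    have "R (i # a) = R (j # b)"
      using rel relation by (metis (no_types, lifting) braid_relations_def case_prodD mem_Collect_eq)
    then have R_eq: "R (j # b @ x) = R u" using x(2)
      by (metis (no_types, opaque_lifting) append_Cons map_append prod_list.append)
    have "length (i # a @ x) = length (j # b @ x)" "set (j # b @ x) \<subseteq> {0..n}"
      using braid_equiv_length[OF step] braid_equiv_set[OF step] n2 by auto
    then have red: "reduced_word n (j # b @ x)" using reduced_wordI[OF x(1), of "j # b @ x"] R_eq x by auto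
    have "braid_equiv n u (i # a @ x)"
      using tail[of i u' "a @ x"] uv lens x Suc.prems by auto
    moreover have "braid_equiv n v (j # b @ x)"
      using tail[of j v' "b @ x"] uv lens red R_eq Suc.prems by auto
    ultimately show ?thesis using step by (metis braid_equiv.sym braid_equiv.trans append_Cons)
  qed
qed

text \<open>All relations preserve the parity of the length, so left multiplication by a generator
  changes the minimal length by exactly one; here it must decrease.\<close>

lemma reduced_left_descent:
  assumes "reduced_word n u" "i \<in> {0..n}" "\<not> reduced_word n (i # u)"
  shows "\<exists>v. reduced_word n (i # v) \<and> R (i # v) = R u \<and> length u = Suc (length v)"
proof -
  have set_u: "set u \<subseteq> {0..n}" using assms by (auto simp: reduced_word_def)
  obtain v where v: "reduced_word n v" "coxeter_equiv n (i # u) v"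
    using ex_reduced_word[of "i # u"] assms set_u by auto
  have sets: "set v \<subseteq> {0..n}" using v by (auto simp: reduced_word_def)
  have "R (i # u) = R v" using v(2) realize[of "i # u" v] sets set_u assms by auto
  then have eq: "R (i # v) = R u" using assms by (metis list.simps(9) prod_list.Cons r_cancel)
  have "length v \<le> Suc (length u)"
    using reduced_wordD[OF v(1), of "i # u"] \<open>R (i # u) = R v\<close> set_u assms by auto
  moreover have "length v \<noteq> Suc (length u)"
    using reduced_wordI[OF v(1), of "i # u"] \<open>R (i # u) = R v\<close> set_u assms by auto
  moreover have "length u \<le> Suc (length v)"
    using reduced_wordD[OF assms(1), of "i # v"] eq sets assms by auto
  moreover have "even (length v) \<longleftrightarrow> odd (length u)"
    using coxeter_equiv_even_length[OF v(2)] by auto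
  ultimately have len: "length u = Suc (length v)"
    by (metis even_Suc le_antisym le_SucE not_less_eq_eq)
  then have "reduced_word n (i # v)"
    using reduced_wordI[OF assms(1), of "i # v"] eq sets assms by auto
  then show ?thesis using eq len by blast
qed

end

section \<open>Polynomial evaluation and the action\<close>

lemma mult_left_commute_if:
  fixes b c :: "'a::semigroup_mult"
  assumes "b * c = c * b"
  shows "b * (c * d) = c * (b * d)"
  using assms by (metis mult.assoc)

lemma prod_list_power_commutes:
  fixes X :: "nat \<Rightarrow> 'a::monoid_mult"
  assumes "\<And>j. j \<in> set js \<Longrightarrow> x * X j = X j * x"
  shows "x * prod_list (map (\<lambda>j. X j ^ \<mu> j) js) = prod_list (map (\<lambda>j. X j ^ \<mu> j) js) * x"
  using assms
proof (induction js)
  case (Cons j js)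
  have "x * X j ^ \<mu> j = X j ^ \<mu> j * x"
    using Cons.prems by (metis power_commuting_commutes list.set_intros(1))
  moreover have "x * prod_list (map (\<lambda>j. X j ^ \<mu> j) js) = prod_list (map (\<lambda>j. X j ^ \<mu> j) js) * x"
    using Cons by auto
  ultimately show ?case
    using mult_left_commute_if[of x "X j ^ \<mu> j"] by (simp add: mult.assoc)
qed simp

lemma monomial_plus:
  fixes X :: "nat \<Rightarrow> 'a::ring_1"
  assumes "\<And>i j. i \<in> {1..n} \<Longrightarrow> j \<in> {1..n} \<Longrightarrow> X i * X j = X j * X i"
  shows "monomial n X (\<lambda>j. \<mu> j + \<nu> j) = monomial n X \<mu> * monomial n X \<nu>"
proof -
  let ?P = "\<lambda>\<mu> js. prod_list (map (\<lambda>j. X j ^ \<mu> j) js)"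
  have "?P (\<lambda>j. \<mu> j + \<nu> j) js = ?P \<mu> js * ?P \<nu> js" if "set js \<subseteq> {1..n}" for js
    using that
  proof (induction js)
    case (Cons j js)
    have "X j ^ \<nu> j * ?P \<mu> js = ?P \<mu> js * X j ^ \<nu> j"
    proof (rule prod_list_power_commutes)
      fix k assume "k \<in> set js"
      then have "X j * X k = X k * X j" using assms Cons.prems by auto
      then show "X j ^ \<nu> j * X k = X k * X j ^ \<nu> j" by (metis power_commuting_commutes)
    qed
    from mult_left_commute_if[OF this, of "?P \<nu> js"] show ?case using Cons by (simp add: power_add mult.assoc)
  qed simp
  moreover have "set [1..<Suc n] \<subseteq> {1..n}" by auto
  ultimately show ?thesis unfolding monomial_def by blast
qed

lemma monomial_single:
  assumes "j \<in> {1..n}"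
  shows "monomial n X (Poly_Mapping.lookup (Poly_Mapping.single j e)) = X j ^ e"
proof -
  have "prod_list (map (\<lambda>i. X i ^ Poly_Mapping.lookup (Poly_Mapping.single j e) i) js)
      = (if j \<in> set js then X j ^ e else 1)" if "distinct js" for js
    using that by (induction js) (auto simp: lookup_single when_def)
  then show ?thesis using assms by (simp add: monomial_def del: upt_Suc)
qed

lemma monomial_zero: "monomial n X (\<lambda>_. 0) = 1"
proof -
  have "prod_list (map (\<lambda>j. X j ^ 0) js) = 1" for js by (induction js) auto
  then show ?thesis unfolding monomial_def by (simp del: upt_Suc)
qed

lemma Const_add: "Const (a + b) = Const a + Const b"
  and Const_mult: "Const (a * b) = Const a * Const b"
  and Const_1: "Const 1 = 1"
  by (simp_all add: Const_def single_add mult_single)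

text \<open>With the polynomial ring viewed as an algebra, \<open>act\<close> is an evaluation in it
  at the reflected variables, and its homomorphism laws become instances of those of
  \<open>poly_eval\<close>.\<close>

interpretation cpoly: complex_algebra "\<lambda>c q. Const c * (q :: cpoly)"
  by unfold_locales (simp_all add: Const_add Const_mult Const_1 algebra_simps)

lemma polys_sum: "(\<And>i. i \<in> S \<Longrightarrow> f i \<in> polys n) \<Longrightarrow> sum f S \<in> polys n"
  by (induction S rule: infinite_finite_induct) (auto intro: polys_add)

lemma polys_monomial:
  assumes "\<And>j. j \<in> {1..n} \<Longrightarrow> Y j \<in> polys m"
  shows "monomial n Y \<mu> \<in> polys m"
proof -
  have "prod_list (map (\<lambda>j. Y j ^ \<mu> j) js) \<in> polys m" if "set js \<subseteq> {1..n}" for js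
    using that by (induction js) (auto intro!: polys_mult polys_power assms)
  moreover have "set [1..<Suc n] \<subseteq> {1..n}" by auto
  ultimately show ?thesis unfolding monomial_def by blast
qed

lemma polys_poly_eval:
  assumes "\<And>j. j \<in> {1..n} \<Longrightarrow> Y j \<in> polys m"
  shows "poly_eval (\<lambda>c q. Const c * q) n Y p \<in> polys m"
  unfolding poly_eval_def by (intro polys_sum polys_mult polys_Const polys_monomial assms)

lemma polys_single: "Poly_Mapping.keys m \<subseteq> {1..n} \<Longrightarrow> Poly_Mapping.single m c \<in> polys n"
  by (simp add: polys_def)

context complex_algebra
begin

context
  fixes n :: nat and X :: "nat \<Rightarrow> 'a"
  assumes comm: "\<And>i j. i \<in> {1..n} \<Longrightarrow> j \<in> {1..n} \<Longrightarrow> X i * X j = X j * X i"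
begin

lemma eval_single:
  "poly_eval scale n X (Poly_Mapping.single m c) = scale c (monomial n X (Poly_Mapping.lookup m))"
  by (rule poly_eval_single) simp

lemma eval_add: "poly_eval scale n X (p + q) = poly_eval scale n X p + poly_eval scale n X q"
  by (rule poly_eval_add) (simp_all add: scale_left_distrib)

lemma eval_0: "poly_eval scale n X 0 = 0"
  by (simp add: poly_eval_def)

lemma eval_diff: "poly_eval scale n X (p - q) = poly_eval scale n X p - poly_eval scale n X q"
  using eval_add[of "p - q" q] by simp

lemma eval_uminus: "poly_eval scale n X (- q) = - poly_eval scale n X q"
  using eval_diff[of 0 q] by (simp add: eval_0)

lemma eval_sum: "poly_eval scale n X (sum f S) = (\<Sum>i\<in>S. poly_eval scale n X (f i))"
  by (induction S rule: infinite_finite_induct) (simp_all add: eval_0 eval_add)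

lemma eval_mult: "poly_eval scale n X (p * q) = poly_eval scale n X p * poly_eval scale n X q"
proof -
  have mono: "monomial n X (\<lambda>k. \<mu> k + \<nu> k) = monomial n X \<mu> * monomial n X \<nu>" for \<mu> \<nu>
    by (rule monomial_plus) (rule comm)
  have single: "poly_eval scale n X (p * Poly_Mapping.single m c)
      = poly_eval scale n X p * poly_eval scale n X (Poly_Mapping.single m c)" for m c
    by (induction p rule: cpoly_induct)
      (simp_all add: eval_0 distrib_right eval_add mult_single,
        simp add: eval_single plus_poly_mapping.rep_eq mono mult.commute
        flip: scale_mult_left scale_mult_right)
  show ?thesis
    by (induction q rule: cpoly_induct) (simp_all add: eval_0 distrib_left eval_add single)
qed

lemma eval_Const: "poly_eval scale n X (Const c) = scale c 1"
  using monomial_zero[of n X] by (simp add: Const_def eval_single zero_poly_mapping.rep_eq)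

lemma eval_1: "poly_eval scale n X 1 = 1"
  using eval_Const[of 1] by (simp add: Const_1)

lemma eval_Var: "j \<in> {1..n} \<Longrightarrow> poly_eval scale n X (Var j) = X j"
  by (simp add: Var_def eval_single monomial_single)

lemma eval_power: "poly_eval scale n X (p ^ e) = poly_eval scale n X p ^ e"
  by (induction e) (simp_all add: eval_1 eval_mult)

lemma eval_monomial:
  "poly_eval scale n X (monomial k Y \<mu>) = monomial k (\<lambda>j. poly_eval scale n X (Y j)) \<mu>"
proof -
  have "poly_eval scale n X (prod_list (map (\<lambda>j. Y j ^ \<mu> j) js))
      = prod_list (map (\<lambda>j. poly_eval scale n X (Y j) ^ \<mu> j) js)" for js
    by (induction js) (simp_all add: eval_1 eval_mult eval_power)
  then show ?thesis unfolding monomial_def .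
qed

end

end

lemma act_diff: "act n i (p - q) = act n i p - act n i q"
  and act_0: "act n i 0 = 0"
  and act_mult: "act n i (p * q) = act n i p * act n i q"
  and act_Const: "act n i (Const c) = Const c"
  and act_1: "act n i 1 = 1"
  and act_Var: "j \<in> {1..n} \<Longrightarrow> act n i (Var j) = reflect n i Var j"
  and act_sum: "act n i (sum f S) = (\<Sum>i'\<in>S. act n i (f i'))"
  and act_monomial: "act n i (monomial k Y \<mu>) = monomial k (\<lambda>j. act n i (Y j)) \<mu>"
proof -
  have ac: "reflect n i Var a * reflect n i Var b = reflect n i Var b * reflect n i Var a" for a b
    by (rule mult.commute)
  show "act n i (p - q) = act n i p - act n i q"
    and "act n i 0 = 0"
    and "act n i (p * q) = act n i p * act n i q"
    and "act n i (Const c) = Const c"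
    and "act n i 1 = 1"
    and "j \<in> {1..n} \<Longrightarrow> act n i (Var j) = reflect n i Var j"
    and "act n i (sum f S) = (\<Sum>i'\<in>S. act n i (f i'))"
    and "act n i (monomial k Y \<mu>) = monomial k (\<lambda>j. act n i (Y j)) \<mu>"
  unfolding act_def
  by (simp_all add: cpoly.eval_diff cpoly.eval_0 cpoly.eval_mult cpoly.eval_Const
      cpoly.eval_1 cpoly.eval_Var cpoly.eval_sum cpoly.eval_monomial ac)
qed

lemma act_uminus: "act n i (- p) = - act n i p"
  using act_diff[of n i 0 p] by (simp add: act_0)

lemma reflect_Var_polys:
  "1 \<le> n \<Longrightarrow> i \<in> {0..n} \<Longrightarrow> j \<in> {1..n} \<Longrightarrow> reflect n i Var j \<in> polys n"
  by (auto simp: reflect_def intro!: polys_Var polys_diff polys_uminus)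

lemma act_polys: "1 \<le> n \<Longrightarrow> i \<in> {0..n} \<Longrightarrow> act n i p \<in> polys n"
  unfolding act_def by (rule polys_poly_eval) (rule reflect_Var_polys)

lemma act_act:
  assumes "1 \<le> n" "i \<in> {0..n}" "p \<in> polys n"
  shows "act n i (act n i p) = p"
proof -
  have Var: "act n i (act n i (Var j)) = Var j" if "j \<in> {1..n}" for j
    using that assms by (auto simp: act_Var reflect_def act_diff act_1 act_uminus)
  have "monomial n (\<lambda>j. act n i (act n i (Var j))) \<mu> = monomial n Var \<mu>" for \<mu>
    unfolding monomial_def
    by (intro arg_cong[where f = prod_list] map_cong) (auto simp: Var simp del: upt_Suc)
  moreover have "act n i (act n i p)
      = act n i (act n i (poly_eval (\<lambda>c q. Const c * q) n Var p))"
    by (simp add: poly_eval_Var[OF assms(3)])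
  ultimately have "act n i (act n i p) = poly_eval (\<lambda>c q. Const c * q) n Var p"
    by (simp add: poly_eval_def act_sum act_mult act_Const act_monomial)
  then show ?thesis by (simp add: poly_eval_Var[OF assms(3)])
qed

lemma act_eq_0_iff:
  assumes "1 \<le> n" "i \<in> {0..n}" "p \<in> polys n"
  shows "act n i p = 0 \<longleftrightarrow> p = 0"
  by (metis act_0 act_act[OF assms])

section \<open>The length filtration\<close>

locale daha = degenerate_daha scale n k r X
  for scale :: "complex \<Rightarrow> 'a::ring_1 \<Rightarrow> 'a" and n k r X +
  assumes n2: "2 \<le> n"
begin

abbreviation ev :: "cpoly \<Rightarrow> 'a" where "ev \<equiv> poly_eval scale n X"
abbreviation R :: "nat list \<Rightarrow> 'a" where "R u \<equiv> prod_list (map r u)"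
abbreviation cls :: "nat list \<Rightarrow> nat list set" where "cls u \<equiv> {v. coxeter_equiv n u v}"

lemma n1: "1 \<le> n" using n2 by simp

lemma ev_add: "ev (p + q) = ev p + ev q"
  and ev_diff: "ev (p - q) = ev p - ev q"
  and ev_uminus: "ev (- p) = - ev p"
  and ev_0: "ev 0 = 0"
  and ev_1: "ev 1 = 1"
  and ev_mult: "ev (p * q) = ev p * ev q"
  and ev_Const: "ev (Const c) = scale c 1"
  and ev_Var: "j \<in> {1..n} \<Longrightarrow> ev (Var j) = X j"
  and ev_single: "ev (Poly_Mapping.single m c) = scale c (monomial n X (Poly_Mapping.lookup m))"
  subgoal by (rule eval_add) (use X_commute in auto)
  subgoal by (rule eval_diff) (use X_commute in auto)
  subgoal by (rule eval_uminus) (use X_commute in auto)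
  subgoal by (rule eval_0) (use X_commute in auto)
  subgoal by (rule eval_1) (use X_commute in auto)
  subgoal by (rule eval_mult) (use X_commute in auto)
  subgoal by (rule eval_Const) (use X_commute in auto)
  subgoal by (rule eval_Var) (use X_commute in auto)
  subgoal by (rule eval_single) (use X_commute in auto)
  done

lemma ev_Const_mult: "ev (Const c * p) = scale c (ev p)"
  by (simp add: ev_mult ev_Const flip: scale_mult_left)

lemma cross:
  assumes "i \<in> {0..n}" "p \<in> polys n"
  obtains q where "q \<in> polys n" "r i * ev p = ev (act n i p) * r i + ev q"
proof -
  obtain q where q: "q \<in> polys n" "affine_root n i * q = act n i p - p"
    using ex1_quotient[OF n1 assms] by blast
  have "r i * ev p = ev (act n i p) * r i + ev (Const (k i) * q)"
    using cross_relation[OF assms q] unfolding ev_Const_mult by (simp add: algebra_simps)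
  then show ?thesis using that[of "Const (k i) * q"] q by (simp add: polys_mult)
qed

lemma cross':
  assumes "i \<in> {0..n}" "p \<in> polys n"
  obtains q where "q \<in> polys n" "ev p * r i = r i * ev (act n i p) + ev q"
proof -
  obtain q where q: "q \<in> polys n" "r i * ev (act n i p) = ev p * r i + ev q"
    using cross[OF assms(1) act_polys[OF n1 assms(1)], of p] act_act[OF n1 assms] by metis
  then have "ev p * r i = r i * ev (act n i p) + ev (- q)"
    by (simp add: ev_uminus)
  then show ?thesis using that[of "- q"] q polys_uminus by blast
qed

lemma R_equiv:
  assumes "coxeter_equiv n u v"
  shows "R u = R v"
  using assms
proof (induction rule: coxeter_equiv.induct)
  case (step u v l l')
  then show ?case using group_relations[OF step(3)] by simp
qed simp_all

lemma cls_eq: "coxeter_equiv n u v \<Longrightarrow> cls u = cls v"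
  using coxeter_equiv.sym coxeter_equiv.trans by blast

lemma cls_self: "set u \<subseteq> {0..n} \<Longrightarrow> u \<in> cls u"
  by (simp add: coxeter_equiv.refl)

lemma cls_in_group: "set u \<subseteq> {0..n} \<Longrightarrow> cls u \<in> coxeter_group n"
  unfolding coxeter_group_def quotient_def by auto

lemma group_cls: "w \<in> coxeter_group n \<Longrightarrow> u \<in> w \<Longrightarrow> set u \<subseteq> {0..n} \<and> w = cls u"
proof -
  assume "w \<in> coxeter_group n" "u \<in> w"
  then obtain v where v: "w = cls v" "coxeter_equiv n v u"
    unfolding coxeter_group_def quotient_def by auto
  then show ?thesis using coxeter_equiv_set[OF v(2) n1] cls_eq[OF v(2)] by blast
qed

lemma group_elem_cls:
  assumes "set u \<subseteq> {0..n}"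
  shows "group_elem r (cls u) = R u"
proof -
  have "(\<lambda>u. R u) ` cls u = {R u}"
    using cls_self[OF assms] R_equiv[of u, symmetric] by (intro set_eqI iffI) blast+
  then show ?thesis by (simp add: group_elem_def)
qed

lemma mult_map_superset:
  assumes "finite S" "Poly_Mapping.keys f \<subseteq> S"
  shows "mult_map scale n r X f = (\<Sum>w\<in>S. group_elem r w * ev (Poly_Mapping.lookup f w))"
  unfolding mult_map_def
  by (rule sum.mono_neutral_left) (use assms in \<open>auto simp: in_keys_iff ev_0\<close>)

lemma mult_map_add:
  "mult_map scale n r X (f + g) = mult_map scale n r X f + mult_map scale n r X g"
proof -
  let ?S = "Poly_Mapping.keys f \<union> Poly_Mapping.keys g"
  have "Poly_Mapping.keys (f + g) \<subseteq> ?S" by (rule keys_add)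
  then show ?thesis
    by (simp add: mult_map_superset[of ?S] lookup_add ev_add distrib_left sum.distrib)
qed

lemma mult_map_single:
  "set u \<subseteq> {0..n} \<Longrightarrow> mult_map scale n r X (Poly_Mapping.single (cls u) p) = R u * ev p"
  by (simp add: mult_map_def group_elem_cls ev_0)

text \<open>The coefficients of \<open>x\<close> with respect to the decomposition into the subspaces
  \<open>w \<cdot> \<complex>[X]\<close>.\<close>
definition coef :: "'a \<Rightarrow> nat list set \<Rightarrow>\<^sub>0 cpoly" where
  "coef = the_inv_into (group_poly_tensor n) (mult_map scale n r X)"

lemma coef_mult_map: "f \<in> group_poly_tensor n \<Longrightarrow> coef (mult_map scale n r X f) = f"
  using tensor_iso unfolding coef_def bij_betw_def by (simp add: the_inv_into_f_f)

lemma coef_eqE: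
  obtains f where "f \<in> group_poly_tensor n" "x = mult_map scale n r X f"
  using tensor_iso unfolding bij_betw_def by (metis UNIV_I imageE)

lemma coef_add: "coef (x + y) = coef x + coef y"
proof -
  obtain f g where "f \<in> group_poly_tensor n" "x = mult_map scale n r X f"
    and "g \<in> group_poly_tensor n" "y = mult_map scale n r X g"
    using coef_eqE by metis
  moreover from this have "f + g \<in> group_poly_tensor n"
    using keys_add[of f g]
    by (fastforce simp: group_poly_tensor_def lookup_add in_keys_iff intro!: polys_add)
  ultimately show ?thesis by (simp add: coef_mult_map flip: mult_map_add)
qed

lemma coef_0: "coef 0 = 0"
  using coef_add[of 0 0] by simp

lemma coef_sum: "coef (sum f S) = (\<Sum>i\<in>S. coef (f i))"
  by (induction S rule: infinite_finite_induct) (auto simp: coef_0 coef_add)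

lemma coef_R_ev:
  assumes "set u \<subseteq> {0..n}" "p \<in> polys n"
  shows "coef (R u * ev p) = Poly_Mapping.single (cls u) p"
proof -
  have "Poly_Mapping.single (cls u) p \<in> group_poly_tensor n"
    using assms cls_in_group by (auto simp: group_poly_tensor_def lookup_single)
  then show ?thesis using coef_mult_map mult_map_single assms by metis
qed

text \<open>The coefficient vector of \<open>R u\<close> is the polynomial 1 placed at the class of
  \<open>u\<close>, so equal products come from equal classes.\<close>

sublocale coxeter: coxeter_realization n r
proof
  show "2 \<le> n" by (rule n2)
  fix u v :: "nat list" assume uv: "set u \<subseteq> {0..n}" "set v \<subseteq> {0..n}"
  have "coxeter_equiv n u v" if "R u = R v"
  proof -
    have "Poly_Mapping.single (cls u) (1 :: cpoly) = Poly_Mapping.single (cls v) 1"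
      using coef_R_ev[OF uv(1), of 1] coef_R_ev[OF uv(2), of 1] that by simp
    from arg_cong[OF this, of Poly_Mapping.keys] have "cls u = cls v" by simp
    then show ?thesis using cls_self[OF uv(2)] by auto
  qed
  then show "coxeter_equiv n u v \<longleftrightarrow> R u = R v" using R_equiv by blast
qed

definition filt :: "nat \<Rightarrow> 'a set" where
  "filt m = span {R u * ev p | u p. length u < m \<and> set u \<subseteq> {0..n} \<and> p \<in> polys n}"

lemma filt_gen: "length u < m \<Longrightarrow> set u \<subseteq> {0..n} \<Longrightarrow> p \<in> polys n \<Longrightarrow> R u * ev p \<in> filt m"
  unfolding filt_def by (rule span_base) blast

lemma filt_add: "x \<in> filt m \<Longrightarrow> y \<in> filt m \<Longrightarrow> x + y \<in> filt m"
  and filt_0: "0 \<in> filt m"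
  unfolding filt_def by (auto intro: span_add span_zero)

lemma filt_mono: "x \<in> filt m \<Longrightarrow> m \<le> m' \<Longrightarrow> x \<in> filt m'"
  unfolding filt_def by (erule rev_subsetD[OF _ span_mono]) (blast intro: less_le_trans)

lemma filt_induct [consumes 1, case_names 0 add]:
  assumes "x \<in> filt m" "P 0"
    and "\<And>u p y. length u < m \<Longrightarrow> set u \<subseteq> {0..n} \<Longrightarrow> p \<in> polys n \<Longrightarrow> y \<in> filt m \<Longrightarrow> P y
      \<Longrightarrow> P (R u * ev p + y)"
  shows "P x"
proof -
  have "x \<in> filt m \<and> P x"
    using assms(1) unfolding filt_def
  proof (induction rule: span_induct_alt)
    case base
    then show ?case using assms(2) span_zero by blast
  next
    case (step c x y)
    then obtain u p where up: "x = R u * ev p" "length u < m" "set u \<subseteq> {0..n}" "p \<in> polys n"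
      by auto
    have eq: "scale c x = R u * ev (Const c * p)"
      by (simp add: up ev_Const_mult scale_mult_right)
    have cp: "Const c * p \<in> polys n" using up by (simp add: polys_mult)
    then show ?case unfolding eq
      using assms(3)[OF up(2,3) cp, of y] filt_add[OF filt_gen[OF up(2,3) cp], of y] step
      unfolding filt_def by blast
  qed
  then show ?thesis by blast
qed

lemma filt_mult_ev:
  assumes "x \<in> filt m" "q \<in> polys n"
  shows "x * ev q \<in> filt m"
  using assms(1)
proof (induction rule: filt_induct)
  case (add u p y)
  then show ?case using filt_gen[of u m "p * q"] assms(2)
    by (auto simp: distrib_right ev_mult mult.assoc intro!: filt_add polys_mult)
qed (simp add: filt_0)

lemma r_mult_filt:
  assumes "x \<in> filt m" "i \<in> {0..n}"
  shows "r i * x \<in> filt (Suc m)"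
  using assms(1)
proof (induction rule: filt_induct)
  case (add u p y)
  then show ?case using filt_gen[of "i # u" "Suc m" p] assms(2)
    by (auto simp: distrib_left mult.assoc intro!: filt_add)
qed (simp add: filt_0)

text \<open>\<open>twist u p\<close> is \<open>w\<^sup>-\<^sup>1 p\<close> for the group element \<open>w\<close> represented by \<open>u\<close>.\<close>
definition twist :: "nat list \<Rightarrow> cpoly \<Rightarrow> cpoly" where
  "twist u = fold (act n) u"

lemma twist_polys: "set u \<subseteq> {0..n} \<Longrightarrow> p \<in> polys n \<Longrightarrow> twist u p \<in> polys n"
  unfolding twist_def by (induction u arbitrary: p) (auto simp: act_polys[OF n1])

lemma twist_nonzero:
  "set u \<subseteq> {0..n} \<Longrightarrow> p \<in> polys n \<Longrightarrow> p \<noteq> 0 \<Longrightarrow> twist u p \<noteq> 0"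
  unfolding twist_def
proof (induction u arbitrary: p)
  case (Cons i u)
  then show ?case using act_polys[OF n1, of i p] act_eq_0_iff[OF n1, of i p] by simp
qed simp

text \<open>Passing a polynomial through a letter leaves an error in which that letter is replaced
  by a polynomial; every error term therefore has fewer letters than \<open>u\<close>.\<close>

lemma ev_R:
  assumes "set u \<subseteq> {0..n}" "p \<in> polys n"
  shows "ev p * R u - R u * ev (twist u p) \<in> filt (length u)"
  using assms
proof (induction u arbitrary: p)
  case (Cons i u)
  then have i: "i \<in> {0..n}" by simp
  obtain q where q: "q \<in> polys n" "ev p * r i = r i * ev (act n i p) + ev q"
    using cross'[OF i Cons.prems(2)] by blast
  have p': "act n i p \<in> polys n" using act_polys[OF n1 i] .
  let ?d = "\<lambda>p. ev p * R u - R u * ev (twist u p)"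
  have "ev p * R (i # u) = (ev p * r i) * R u" by (simp add: mult.assoc)
  also have "\<dots> = r i * (ev (act n i p) * R u) + ev q * R u"
    unfolding q(2) by (simp add: distrib_right mult.assoc)
  finally have "ev p * R (i # u) - R (i # u) * ev (twist (i # u) p)
      = r i * ?d (act n i p) + (?d q + R u * ev (twist u q))"
    by (simp add: twist_def right_diff_distrib mult.assoc)
  moreover have "r i * ?d (act n i p) \<in> filt (Suc (length u))"
    by (rule r_mult_filt[OF Cons.IH[OF _ p'] i]) (use Cons.prems in simp)
  moreover have "?d q \<in> filt (Suc (length u))"
    by (rule filt_mono[OF Cons.IH[OF _ q(1)]]) (use Cons.prems in simp_all)
  moreover have "R u * ev (twist u q) \<in> filt (Suc (length u))"
    using Cons.prems q(1) by (intro filt_gen twist_polys) simp_all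
  ultimately show ?case by (simp only: filt_add list.size(4) add_Suc_right add_0_right)
qed (simp add: twist_def filt_0)

lemma ev_mult_filt:
  assumes "x \<in> filt m" "q \<in> polys n"
  shows "ev q * x \<in> filt m"
  using assms(1)
proof (induction rule: filt_induct)
  case (add u p y)
  let ?d = "ev q * R u - R u * ev (twist u q)"
  have "ev q * (R u * ev p) = ?d * ev p + R u * ev (twist u q * p)"
    unfolding ev_mult by (simp add: algebra_simps)
  moreover have "?d * ev p \<in> filt m"
    using add ev_R[of u q] assms(2) by (intro filt_mult_ev filt_mono[of ?d "length u" m]) auto
  moreover have "R u * ev (twist u q * p) \<in> filt m"
    using add assms(2) by (intro filt_gen polys_mult twist_polys) auto
  ultimately have "ev q * (R u * ev p) \<in> filt m" by (simp add: filt_add)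
  then show ?case using add by (simp add: distrib_left filt_add)
qed (simp add: filt_0)

text \<open>A word with fewer than \<open>m\<close> letters cannot represent an element all of whose
  words have at least \<open>m\<close>. This isolates leading coefficients.\<close>

lemma coef_filt:
  assumes "x \<in> filt m" "\<And>v. v \<in> w \<Longrightarrow> m \<le> length v"
  shows "Poly_Mapping.lookup (coef x) w = 0"
  using assms(1)
proof (induction rule: filt_induct)
  case (add u p y)
  have "cls u \<noteq> w" using add(1,2) assms(2)[of u] cls_self[of u] by auto
  then show ?case using add by (simp add: coef_add coef_R_ev lookup_add lookup_single)
qed (simp add: coef_0)

end

section \<open>Relations between the elements T\<close>

text \<open>As \<open>(r - 1) * (r - 1) = - 2 * (r - 1)\<close> and \<open>r\<close> commutes with
  \<open>s * r * s\<close>, the products \<open>A * s * A * s\<close> and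
  \<open>s * A * s * A\<close> have the same main term
  \<open>y * z * (r - 1) * (s * r * s - 1)\<close>. Their corrections are
  \<open>- 2 * t * A * s\<close> and \<open>- 2 * t * s * A\<close>.\<close>

lemma length_four_braid:
  fixes r s y z t :: "'a::ring_1"
  assumes "r * r = 1" "s * s = 1" "s * r * s * r = r * s * r * s"
    and "z * y = y * z" "r * z = z * r" and sy: "s * y = z * s + t"
    and "r * t = t * r" "s * t = t * s" "y * t = t * y" "z * t = t * z"
  defines "A \<equiv> y * (r - 1)"
  shows "A * s * A * s - s * A * s * A = t * (s * A - A * s) + t * (s * A - A * s)"
proof -
  note D = distrib_left distrib_right left_diff_distrib right_diff_distrib mult.assoc
  have ext: "a * (b * x) = c * x" if "a * b = c" for a b c x :: 'a
    using that by (simp flip: mult.assoc)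
  \<comment> \<open>Conjugating the relation \<open>sy\<close> by \<open>s\<close> yields the rule
    for moving \<open>s\<close> past \<open>z\<close>, so that all products can be sorted with
    \<open>y\<close> and \<open>z\<close> in front.\<close>
  have "s * (s * y) * s = s * (z * s + t) * s" using sy by simp
  then have "y * s = s * z + t"
    using assms(2) assms(2)[THEN ext] assms(8)[symmetric] by (simp add: D)
  then have sz: "s * z = y * s - t" by simp
  note rules = assms(1,2,3) assms(4,5) sy sz assms(7-10)
  have b: "s * (r * (s * r)) = r * (s * (r * s))" using assms(3) by (simp add: mult.assoc)
  have b': "s * (r * (s * (r * x))) = r * (s * (r * (s * x)))" for x
    using arg_cong[OF b, of "\<lambda>z. z * x"] by (simp add: mult.assoc)
  show ?thesis unfolding A_def
    by (simp add: D rules(1,2,4-) b b' rules(1,2,4-)[THEN ext])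
qed

section \<open>The elements T: shape, cross-relations and leading terms\<close>

locale rational_daha_gens = daha scale n "daha_k n t0 u0 t tn un" r X
  for scale :: "complex \<Rightarrow> 'a::ring_1 \<Rightarrow> 'a" and n t0 u0 t tn un r X
begin

abbreviation T :: "nat \<Rightarrow> 'a" where "T \<equiv> T_gen scale n r X t0 u0 tn un"
abbreviation TW :: "nat list \<Rightarrow> 'a" where "TW \<equiv> T_word scale n r X t0 u0 tn un"

lemma TW_Nil: "TW [] = 1"
  and TW_Cons: "TW (i # u) = T i * TW u"
  and TW_append: "TW (u @ v) = TW u * TW v"
  by (simp_all add: T_word_def)

lemma T_mid: "i \<noteq> 0 \<Longrightarrow> i \<noteq> n \<Longrightarrow> T i = r i"
  by (simp add: T_gen_def)

text \<open>The pair \<open>a\<close>, \<open>b\<close> stands for \<open>t0\<close>,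
  \<open>u0\<close> or for \<open>tn\<close>, \<open>un\<close>, so that both ends of the diagram
  are treated at once.\<close>

lemma T_end:
  assumes "i = 0 \<or> i = n"
  obtains a b where "daha_k n t0 u0 t tn un i = 2 * a + 2 * b"
    "T i = scale a 1 + scale (1/2) ((scale (a - b) 1 + ev (affine_coroot n i)) * (r i - 1))"
proof (cases "i = 0")
  case True
  then show ?thesis using that[of t0 u0] by (simp add: T_gen_def daha_k_def)
next
  case False
  then show ?thesis using that[of tn un] assms by (simp add: T_gen_def daha_k_def)
qed

lemma affine_coroot_polys: "affine_coroot n i \<in> polys n"
  using n2 by (auto simp: affine_coroot_def intro!: polys_diff polys_Var)

text \<open>The linear coefficient at \<open>Var 1\<close> or \<open>Var n\<close> is -1 or 1,
  whatever the constant. This is why the leading coefficient of \<open>T i\<close> vanishes for no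
  choice of parameters.\<close>

lemma Const_coroot_nonzero: "Const c + affine_coroot n i \<noteq> 0"
proof
  have *: "Poly_Mapping.lookup (Const c) (Poly_Mapping.single j 1) = 0"
    "Poly_Mapping.lookup (Var j) (Poly_Mapping.single j 1) = 1" for c and j :: nat
  proof -
    have "Poly_Mapping.single j (1::nat) \<noteq> 0"
      by (metis lookup_single_eq lookup_zero zero_neq_one)
    then show "Poly_Mapping.lookup (Const c) (Poly_Mapping.single j 1) = 0"
      by (simp add: Const_def lookup_single when_def)
  qed (simp add: Var_def)
  let ?j = "if i = 0 then 1 else n"
  assume "Const c + affine_coroot n i = 0"
  then have "Poly_Mapping.lookup (Const c + affine_coroot n i) (Poly_Mapping.single ?j 1) = 0"
    by simp
  then show False
    using *(1)[of _ "1::nat"] *(2)[of "1::nat"] *(1)[of _ n] *(2)[of n]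
    by (auto simp: affine_coroot_def lookup_add lookup_minus split: if_splits)
qed

lemma T_form:
  obtains \<tau> \<sigma> where "\<tau> \<in> polys n" "\<sigma> \<in> polys n" "\<tau> \<noteq> 0" "T i = ev \<tau> * r i + ev \<sigma>"
proof (cases "i = 0 \<or> i = n")
  case True
  obtain a b where T: "T i = scale a 1 + scale (1/2)
      ((scale (a - b) 1 + ev (affine_coroot n i)) * (r i - 1))"
    using T_end[OF True] by metis
  define \<tau> where "\<tau> = Const (1/2) * (Const (a - b) + affine_coroot n i)"
  have poly: "\<tau> \<in> polys n"
    unfolding \<tau>_def by (intro polys_mult polys_add polys_Const affine_coroot_polys)
  have "Const (1/2) \<noteq> 0" by (metis Const_def divide_eq_0_iff lookup_single_eq lookup_zero zero_neq_numeral zero_neq_one)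
  then have "\<tau> \<noteq> 0" using Const_coroot_nonzero unfolding \<tau>_def by simp
  moreover have ev_\<tau>: "ev \<tau> = scale (1/2) (scale (a - b) 1 + ev (affine_coroot n i))"
    unfolding \<tau>_def ev_Const_mult ev_add ev_Const ..
  have "T i = ev \<tau> * (r i - 1) + scale a 1"
    unfolding T ev_\<tau> by (simp only: scale_mult_left[symmetric] add.commute)
  then have "T i = ev \<tau> * r i + ev (Const a - \<tau>)"
    unfolding ev_diff ev_Const by (simp add: right_diff_distrib)
  ultimately show ?thesis using that poly polys_diff polys_Const by blast
next
  case False
  then have "T i = ev 1 * r i + ev 0" by (simp add: T_mid ev_1 ev_0)
  then show ?thesis using that[of 1 0] by simp
qed

text \<open>Replacing \<open>ev \<tau> * r i\<close> by \<open>T i - ev \<sigma>\<close> in the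
  cross-relation of \<open>r i\<close> keeps the reflection and leaves a polynomial error.\<close>

lemma T_cross:
  assumes "i \<in> {0..n}" "p \<in> polys n"
  obtains q where "q \<in> polys n" "T i * ev p = ev (act n i p) * T i + ev q"
proof -
  obtain \<tau> \<sigma> where T: "\<tau> \<in> polys n" "\<sigma> \<in> polys n" "T i = ev \<tau> * r i + ev \<sigma>"
    by (rule T_form)
  obtain q where q: "q \<in> polys n" "r i * ev p = ev (act n i p) * r i + ev q"
    by (rule cross[OF assms])
  let ?p = "act n i p"
  have "?p \<in> polys n" by (rule act_polys[OF n1 assms(1)])
  have "T i * ev p = ev \<tau> * (r i * ev p) + ev (\<sigma> * p)"
    unfolding T ev_mult by (simp add: distrib_right mult.assoc)
  also have "\<dots> = ev (\<tau> * ?p) * r i + (ev (\<tau> * q) + ev (\<sigma> * p))"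
    unfolding q ev_mult by (simp add: distrib_left mult.assoc add.assoc)
  also have "ev (\<tau> * ?p) = ev ?p * ev \<tau>" by (simp add: mult.commute[of \<tau>] ev_mult)
  also have "ev ?p * ev \<tau> * r i = ev ?p * T i - ev (?p * \<sigma>)"
    unfolding T ev_mult by (simp add: distrib_left mult.assoc)
  finally have "T i * ev p = ev ?p * T i + ev (\<tau> * q + \<sigma> * p - ?p * \<sigma>)"
    unfolding ev_add ev_diff by simp
  moreover have "\<tau> * q + \<sigma> * p - ?p * \<sigma> \<in> polys n"
    using T q assms \<open>?p \<in> polys n\<close> by (intro polys_diff polys_add polys_mult)
  ultimately show ?thesis using that by blast
qed

lemma T_cross':
  assumes "i \<in> {0..n}" "p \<in> polys n"
  obtains q where "q \<in> polys n" "ev p * T i = T i * ev (act n i p) + ev q"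
proof -
  obtain q where q: "q \<in> polys n" "T i * ev (act n i p) = ev p * T i + ev q"
    using T_cross[OF assms(1) act_polys[OF n1 assms(1)], of p] act_act[OF n1 assms] by metis
  then have "ev p * T i = T i * ev (act n i p) + ev (- q)"
    by (simp add: ev_uminus)
  then show ?thesis using that[of "- q"] q polys_uminus by blast
qed

text \<open>The leading polynomial grows letter by letter as
  \<open>twist (i # u) \<tau> * f\<close>. It stays nonzero because twists are injective and
  polynomials have no zero divisors; the summand \<open>ev \<sigma>\<close> of \<open>T i\<close>
  contributes only fewer letters.\<close>

lemma TW_leading:
  assumes "set u \<subseteq> {0..n}"
  shows "\<exists>f\<in>polys n. f \<noteq> 0 \<and> TW u - R u * ev f \<in> filt (length u)"
  using assms
proof (induction u)
  case Nil
  then show ?case by (intro bexI[of _ 1]) (simp_all add: TW_Nil ev_1 filt_0)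
next
  case (Cons i u)
  then have iu: "i \<in> {0..n}" "set u \<subseteq> {0..n}" "set (i # u) \<subseteq> {0..n}" by auto
  obtain f where f: "f \<in> polys n" "f \<noteq> 0" "TW u - R u * ev f \<in> filt (length u)"
    using Cons.IH[OF iu(2)] by blast
  define x where "x = TW u - R u * ev f"
  have x: "x \<in> filt (length u)" "TW u = R u * ev f + x" using f by (simp_all add: x_def)
  obtain \<tau> \<sigma> where T: "\<tau> \<in> polys n" "\<sigma> \<in> polys n" "\<tau> \<noteq> 0" "T i = ev \<tau> * r i + ev \<sigma>"
    by (rule T_form)
  let ?L = "filt (length (i # u))"
  let ?g = "twist (i # u) \<tau>"
  let ?d = "ev \<tau> * R (i # u) - R (i # u) * ev ?g"
  have g: "?g \<in> polys n" "?g \<noteq> 0"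
    using twist_polys[OF iu(3) T(1)] twist_nonzero[OF iu(3) T(1,3)] by auto
  have "TW (i # u) - R (i # u) * ev (?g * f)
      = ?d * ev f + ev \<sigma> * (R u * ev f) + (ev \<tau> * (r i * x) + ev \<sigma> * x)"
    unfolding TW_Cons x(2) T(4) ev_mult by (simp add: distrib_left distrib_right left_diff_distrib mult.assoc)
  moreover have "?d * ev f \<in> ?L"
    by (rule filt_mult_ev[OF ev_R[OF iu(3) T(1)] f(1)])
  moreover have "ev \<sigma> * (R u * ev f) \<in> ?L"
    by (rule ev_mult_filt[OF filt_gen[OF _ iu(2) f(1)] T(2)]) simp
  moreover have "ev \<tau> * (r i * x) \<in> ?L"
    using ev_mult_filt[OF r_mult_filt[OF x(1) iu(1)] T(1)] by simp
  moreover have "ev \<sigma> * x \<in> ?L"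
    by (rule filt_mono[OF ev_mult_filt[OF x(1) T(2)]]) simp
  ultimately have "TW (i # u) - R (i # u) * ev (?g * f) \<in> ?L"
    by (simp only: filt_add)
  then show ?case using g f by (intro bexI[of _ "?g * f"]) (auto intro: polys_mult)
qed

section \<open>Quadratic, commutation and length-four relations of the T\<close>

lemma r_ev_commute:
  assumes "i \<in> {0..n}" "p \<in> polys n" "act n i p = p"
  shows "r i * ev p = ev p * r i"
  using cross_relation[OF assms(1,2) polys_0] assms(3) by (simp add: ev_0)

lemma r_ev_sign:
  assumes "i \<in> {0..n}" "p \<in> polys n" "act n i p - p = - affine_root n i"
  shows "r i * ev p = ev (act n i p) * r i - scale (daha_k n t0 u0 t tn un i) 1"
  using cross_relation[OF assms(1,2), of "- 1"] assms(3) polys_uminus[OF polys_1]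
  by (simp add: ev_uminus ev_1 algebra_simps)

text \<open>At an end put \<open>z = a - b + y\<close>, with \<open>y\<close> the coroot, and
  \<open>A = z * (r i - 1)\<close>. The cross-relation gives
  \<open>(r i - 1) * z * (r i - 1) = - 4 * a * (r i - 1)\<close>; the value
  \<open>2 * a + 2 * b\<close> of the parameter makes \<open>b\<close> cancel. Hence
  \<open>A * A = - 4 * a * A\<close>, and \<open>T i = a + A / 2\<close> has square
  \<open>a * a\<close>.\<close>

lemma T_square:
  assumes "i \<in> {0..n}"
  obtains c where "T i * T i = scale c 1"
proof (cases "i = 0 \<or> i = n")
  case True
  obtain a b where ab: "daha_k n t0 u0 t tn un i = 2 * a + 2 * b"
    "T i = scale a 1 + scale (1/2) ((scale (a - b) 1 + ev (affine_coroot n i)) * (r i - 1))"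
    using T_end[OF True] .
  define y where "y = ev (affine_coroot n i)"
  \<comment> \<open>Splitting 1 into two halves shows, for \<open>i = 0\<close>, that the reflection
    negates the coroot and that the root is twice the coroot.\<close>
  have half: "Const (1/2) + Const (1/2) = 1" by (simp add: Const_1 flip: Const_add)
  then have half': "1 = Const (1/2) + Const (1/2)" ..
  have "act n i (affine_coroot n i) = - affine_coroot n i"
  proof (cases "i = 0")
    case True
    then show ?thesis using n2 half'
      by (simp add: affine_coroot_def act_diff act_Const act_Var reflect_def)
  next
    case False
    then show ?thesis using True n2
      by (simp add: affine_coroot_def act_Var reflect_def)
  qed
  moreover have "- affine_coroot n i - affine_coroot n i = - affine_root n i"
    unfolding affine_coroot_def affine_root_def half' using True
    by (auto simp: algebra_simps)
  ultimately have ry: "r i * y = - (y * r i) - scale (2 * a + 2 * b) 1"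
    using r_ev_sign[OF assms affine_coroot_polys] ab(1) by (simp add: y_def ev_uminus)
  have rr: "r i * r i = 1" using coxeter.r_square[OF assms] .
  define z where "z = scale (a - b) 1 + y"
  have rz: "r i * z = - (z * r i) + (scale (2 * (a - b)) (r i) - scale (2 * a + 2 * b) 1)"
  proof -
    have "scale (2 * (a - b)) (r i) = scale (a - b) (r i) + scale (a - b) (r i)"
      by (simp flip: scale_left_distrib)
    then show ?thesis unfolding z_def using ry
      by (simp add: distrib_left distrib_right flip: scale_mult_left scale_mult_right)
  qed
  have scaled: "(scale c (r i) - scale d 1) * (r i - 1) = scale (- c - d) (r i - 1)" for c d
    by (simp add: left_diff_distrib right_diff_distrib rr scale_left_diff_distrib
        scale_right_diff_distrib flip: scale_mult_left scale_mult_right)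
  define A where "A = z * (r i - 1)"
  have "(r i - 1) * z * (r i - 1) = - z * (r i + 1) * (r i - 1)
      + (scale (2 * (a - b)) (r i) - scale (2 * a + 2 * b) 1) * (r i - 1)"
    unfolding left_diff_distrib[of "r i" 1 z] rz by (simp add: algebra_simps)
  also have "- z * (r i + 1) * (r i - 1) = 0"
    by (simp add: algebra_simps rr)
  also have "(scale (2 * (a - b)) (r i) - scale (2 * a + 2 * b) 1) * (r i - 1)
      = scale (- (2 * (a - b)) - (2 * a + 2 * b)) (r i - 1)"
    by (rule scaled)
  also have "- (2 * (a - b)) - (2 * a + 2 * b) = - 4 * a" by simp
  finally have "z * ((r i - 1) * z * (r i - 1)) = z * scale (- 4 * a) (r i - 1)" by simp
  then have "A * A = scale (- 4 * a) A"
    unfolding A_def by (simp add: mult.assoc flip: scale_mult_right)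
  moreover have "scale (2 * a) A = scale a A + scale a A"
    by (simp flip: scale_left_distrib)
  ultimately have "T i * T i = scale (a * a) 1"
    unfolding ab(2) y_def[symmetric] z_def[symmetric] A_def[symmetric]
    by (simp add: distrib_left distrib_right scale_right_distrib
        flip: scale_mult_left scale_mult_right)
  then show ?thesis using that by blast
next
  case False
  then show ?thesis using that[of 1] coxeter.r_square[OF assms] by (simp add: T_mid)
qed

lemma T_commute:
  assumes "x * r i = r i * x"
    and "i = 0 \<or> i = n \<Longrightarrow> x * ev (affine_coroot n i) = ev (affine_coroot n i) * x"
  shows "x * T i = T i * x"
proof (cases "i = 0 \<or> i = n")
  case True
  obtain a b where T: "T i = scale a 1 + scale (1/2)
      ((scale (a - b) 1 + ev (affine_coroot n i)) * (r i - 1))"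
    using T_end[OF True] by metis
  define y where "y = scale (a - b) 1 + ev (affine_coroot n i)"
  have y: "x * y = y * x"
    unfolding y_def by (simp add: distrib_left distrib_right assms(2)[OF True]
        flip: scale_mult_left scale_mult_right)
  have "x * (y * (r i - 1)) = y * (r i - 1) * x"
    by (simp add: mult_left_commute_if[OF y] right_diff_distrib left_diff_distrib assms(1) mult.assoc y)
  then show ?thesis
    unfolding T y_def[symmetric]
    by (simp add: distrib_left distrib_right flip: scale_mult_left scale_mult_right)
qed (simp add: T_mid assms)

text \<open>As \<open>i < j\<close>, only \<open>i\<close> can be the end 0 and only
  \<open>j\<close> the end \<open>n\<close>. The coroots there involve only the first and the last
  variable, which the other reflection fixes. So \<open>T_commute\<close> can be applied to
  \<open>r i\<close>, then to the coroot of 0, then to \<open>T j\<close>.\<close>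

lemma T_far_commute:
  assumes "i + 2 \<le> j" "j \<le> n"
  shows "T i * T j = T j * T i"
proof -
  have ij: "i \<in> {0..n}" "j \<in> {0..n}" using assms by auto
  have rr: "r i * r j = r j * r i"
    using group_relations[of "[i, j]" "[j, i]"] assms by (auto simp: coxeter_relations_def)
  have coroot_comm: "ev (affine_coroot n a) * ev (affine_coroot n b)
      = ev (affine_coroot n b) * ev (affine_coroot n a)" for a b
    unfolding ev_mult[symmetric] by (simp only: mult.commute)
  have "act n i (affine_coroot n n) = affine_coroot n n"
    using assms n2 by (auto simp: affine_coroot_def act_Var reflect_def)
  then have r_i: "r i * ev (affine_coroot n n) = ev (affine_coroot n n) * r i"
    by (rule r_ev_commute[OF ij(1) affine_coroot_polys])
  have "act n j (affine_coroot n 0) = affine_coroot n 0"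
    using assms n2 by (auto simp: affine_coroot_def act_diff act_Const act_Var reflect_def)
  then have r_j: "r j * ev (affine_coroot n 0) = ev (affine_coroot n 0) * r j"
    by (rule r_ev_commute[OF ij(2) affine_coroot_polys])
  have "r i * T j = T j * r i"
    by (rule T_commute) (use rr r_i assms in auto)
  moreover have "ev (affine_coroot n 0) * T j = T j * ev (affine_coroot n 0)"
    by (rule T_commute) (use r_j coroot_comm in auto)
  ultimately have "T j * T i = T i * T j"
    by (intro T_commute) (use assms in auto)
  then show ?thesis ..
qed

lemma T_length_four:
  assumes "e = 0 \<and> j = 1 \<or> e = n \<and> j = n - 1"
  shows "T e * T j * T e * T j - T j * T e * T j * T e = scale t (T j * T e - T e * T j)"
proof -
  have ej: "e \<in> {0..n}" "j \<in> {0..n}" "e = 0 \<or> e = n" "j \<noteq> 0" "j \<noteq> n"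
    using assms n2 by auto
  obtain a b where T: "T e = scale a 1 + scale (1/2)
      ((scale (a - b) 1 + ev (affine_coroot n e)) * (r e - 1))"
    using T_end[OF ej(3)] by metis
  \<comment> \<open>The difference of \<open>p\<close> and the coroot of \<open>e\<close> is the
    root of \<open>j\<close>, so the quotient in the cross-relation is 1 and the correction is the
    scalar \<open>t\<close>. Moreover \<open>r e\<close> fixes \<open>p\<close>, so
    \<open>ev p\<close> can play the part of \<open>z\<close> in
    \<open>length_four_braid\<close>.\<close>
  define p where "p = act n j (affine_coroot n e)"
  have p: "p \<in> polys n" unfolding p_def by (rule act_polys[OF n1 ej(2)])
  have p_eq: "p = (if e = 0 then Const (1/2) - Var 2 else Var (n - 1))"
    using assms n2
    by (auto simp: p_def affine_coroot_def act_diff act_Const act_Var reflect_def numeral_2_eq_2)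
  have "act n e p = p"
    using assms n2 unfolding p_eq
    by (auto simp: act_diff act_Const act_Var reflect_def)
  then have rz: "r e * ev p = ev p * r e" by (rule r_ev_commute[OF ej(1) p])
  have "affine_root n j * 1 = act n j (affine_coroot n e) - affine_coroot n e"
    using assms n2 unfolding p_def[symmetric] p_eq
    by (auto simp: affine_root_def affine_coroot_def numeral_2_eq_2)
  from cross_relation[OF ej(2) affine_coroot_polys polys_1 this]
  have sy: "r j * ev (affine_coroot n e) = ev p * r j + scale t 1"
    using ej by (simp add: p_def ev_1 daha_k_def algebra_simps)
  define y z where "y = scale (a - b) 1 + ev (affine_coroot n e)" and "z = scale (a - b) 1 + ev p"
  note scl = scale_mult_left[symmetric] scale_mult_right[symmetric]
  have yz: "z * y = y * z"
    unfolding y_def z_def ev_Const[symmetric] ev_add[symmetric] ev_mult[symmetric]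
    by (simp only: mult.commute)
  have "r j * r e * r j * r e = r e * r j * r e * r j"
    using group_relations[of "[0, 1, 0, 1]" "[1, 0, 1, 0]"]
      group_relations[of "[n-1, n, n-1, n]" "[n, n-1, n, n-1]"] assms n2
    by (auto simp: coxeter_relations_def mult.assoc)
  note br = this
  have c: "x * scale t 1 = scale t 1 * x" for x by (simp add: scl)
  have rz': "r e * z = z * r e" and sy': "r j * y = z * r j + scale t 1"
    using sy rz by (simp_all add: scl y_def z_def distrib_left distrib_right add.assoc)
  have A: "A * r j * A * r j - r j * A * r j * A
      = scale t (r j * A - A * r j) + scale t (r j * A - A * r j)" if "A = y * (r e - 1)" for A
    using length_four_braid[OF coxeter.r_square[OF ej(1)] coxeter.r_square[OF ej(2)] br yz
        rz' sy' c c c c] that by (simp flip: scale_mult_left)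
  define A where "A = y * (r e - 1)"
  have T': "T e = scale a 1 + scale (1/2) A" unfolding T A_def y_def ..
  have rr: "r j * r j = 1" "r j * (r j * x) = x" for x
    using coxeter.r_square[OF ej(2)] coxeter.r_cancel[OF ej(2)] by auto
  \<comment> \<open>With \<open>T e = a + A / 2\<close>, the terms containing at most one factor
    \<open>A\<close> are the same on both sides because \<open>r j * r j = 1\<close>.\<close>
  have "T e * T j * T e * T j - T j * T e * T j * T e
      = scale (1/4) (A * r j * A * r j - r j * A * r j * A)"
    unfolding T' T_mid[OF ej(4,5)]
    by (simp add: distrib_left distrib_right scl mult.assoc rr scale_right_distrib
        scale_right_diff_distrib)
  also have "\<dots> = scale (t / 2) (r j * A - A * r j)"
    unfolding A[OF A_def] by (simp add: scale_left_distrib[symmetric] flip: scale_right_distrib)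
  also have "\<dots> = scale t (T j * T e - T e * T j)"
    unfolding T' T_mid[OF ej(4,5)]
    by (simp add: distrib_left distrib_right scl scale_right_distrib scale_right_diff_distrib)
  finally show ?thesis .
qed

text \<open>Scalar combinations suffice here: the corrections in \<open>T_square\<close> and
  \<open>T_length_four\<close> have scalar coefficients, so rewriting words in the
  \<open>T i\<close> never produces polynomials.\<close>

definition Tfilt :: "nat \<Rightarrow> 'a set" where
  "Tfilt m = span {TW u | u. length u < m \<and> set u \<subseteq> {0..n}}"

lemma Tfilt_gen: "length u < m \<Longrightarrow> set u \<subseteq> {0..n} \<Longrightarrow> TW u \<in> Tfilt m"
  unfolding Tfilt_def by (rule span_base) blast

lemma TW_mult_Tfilt:
  assumes "x \<in> Tfilt m" "set a \<subseteq> {0..n}" "set b \<subseteq> {0..n}"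
  shows "TW a * x * TW b \<in> Tfilt (length a + m + length b)"
  using assms(1) unfolding Tfilt_def
proof (induction rule: span_induct_alt)
  case base
  then show ?case by (simp add: span_zero)
next
  case (step c x y)
  then obtain u where u: "x = TW u" "length u < m" "set u \<subseteq> {0..n}" by auto
  have "TW a * x * TW b \<in> span {TW v | v. length v < length a + m + length b \<and> set v \<subseteq> {0..n}}"
    using u assms(2,3)
    by (intro span_base CollectI exI[of _ "a @ u @ b"]) (simp add: TW_append mult.assoc)
  then show ?case using step(2)
    by (simp add: distrib_left distrib_right span_add span_scale
        scale_mult_left[symmetric] scale_mult_right[symmetric])
qed

text \<open>Only the relations at the two ends are disturbed, and there the defect is a multiple of
  a commutator of two letters; the others hold exactly.\<close>

lemma TW_braid_relation:
  assumes "(l, l') \<in> braid_relations n"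
  shows "TW l - TW l' \<in> Tfilt (length l)"
proof -
  have zero: "0 \<in> Tfilt m" for m by (simp add: Tfilt_def span_zero)
  have rel4: "TW [e, j, e, j] - TW [j, e, j, e] \<in> Tfilt 4"
    "TW [j, e, j, e] - TW [e, j, e, j] \<in> Tfilt 4"
    if "e = 0 \<and> j = 1 \<or> e = n \<and> j = n - 1" for e j
  proof -
    have "TW [e, j, e, j] - TW [j, e, j, e] = scale t (TW [j, e] - TW [e, j])"
      using T_length_four[OF that] by (simp add: TW_Cons TW_Nil mult.assoc)
    moreover have "TW [j, e] \<in> Tfilt 4" "TW [e, j] \<in> Tfilt 4"
      using that n2 by (auto intro!: Tfilt_gen)
    ultimately show *: "TW [e, j, e, j] - TW [j, e, j, e] \<in> Tfilt 4"
      by (simp add: Tfilt_def span_diff span_scale)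
    then have "- (TW [e, j, e, j] - TW [j, e, j, e]) \<in> Tfilt 4"
      unfolding Tfilt_def by (rule span_neg)
    then show "TW [j, e, j, e] - TW [e, j, e, j] \<in> Tfilt 4" by simp
  qed
  consider (four) i where "i \<in> {0, n-1}" "l = [i, i+1, i, i+1]" "l' = [i+1, i, i+1, i]"
    | (three) i where "i \<in> {1..n-2}" "l = [i, i+1, i]" "l' = [i+1, i, i+1]"
    | (two) i j where "i \<le> n" "j \<le> n" "i + 2 \<le> j \<or> j + 2 \<le> i" "l = [i, j]" "l' = [j, i]"
    using assms unfolding braid_relations_def coxeter_relations_def by auto
  then show ?thesis
  proof cases
    case four
    then consider "i = 0" | "i = n - 1" by auto
    then show ?thesis
    proof cases
      case 1
      then show ?thesis using rel4(1)[of 0 1] four by (simp add: numeral_eq_Suc)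
    next
      case 2
      \<comment> \<open>Here the end letter is \<open>i + 1 = n\<close>, the second one, so the
        relation is read backwards.\<close>
      then show ?thesis using rel4(2)[of n "n - 1"] four n2 by (simp add: numeral_eq_Suc)
    qed
  next
    case three
    then have "i \<noteq> 0" "i \<noteq> n" "i + 1 \<noteq> 0" "i + 1 \<noteq> n" "(l, l') \<in> coxeter_relations n"
      using n2 assms by (auto simp: braid_relations_def)
    then have "TW l = TW l'"
      using three group_relations[of l l'] T_mid[of i] T_mid[of "i + 1"]
      by (simp add: TW_Cons TW_Nil)
    then show ?thesis by (simp add: zero)
  next
    case two
    then have "TW l = TW l'"
      using T_far_commute[of i j] T_far_commute[of j i] by (auto simp: TW_Cons TW_Nil)
    then show ?thesis by (simp add: zero)
  qed
qed

end

section \<open>Bases\<close>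

lemma (in complex_algebra) is_linear_basisI:
  assumes indep: "\<And>S c i. finite S \<Longrightarrow> S \<subseteq> I \<Longrightarrow> (\<Sum>i\<in>S. scale (c i) (b i)) = 0 \<Longrightarrow> i \<in> S \<Longrightarrow> c i = 0"
    and "span (b ` I) = V"
  shows "is_linear_basis scale I b V"
proof -
  have inj: "inj_on b I"
  proof (rule inj_onI, rule ccontr)
    fix i j assume ij: "i \<in> I" "j \<in> I" "b i = b j" "i \<noteq> j"
    \<comment> \<open>Equal vectors at two indices would satisfy the relation with coefficients 1
      and -1.\<close>
    have "(\<Sum>k\<in>{i, j}. scale (if k = i then 1 else - 1) (b k)) = 0"
      using ij by simp
    from indep[OF _ _ this, of i] ij show False by auto
  qed
  moreover have "independent (b ` I)"
    unfolding dependent_explicit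
  proof safe
    fix t u v assume t: "finite t" "t \<subseteq> b ` I" "(\<Sum>v\<in>t. scale (u v) v) = 0" "v \<in> t" "u v \<noteq> 0"
    obtain S where S: "S \<subseteq> I" "t = b ` S" using t(2) by (metis subset_imageE)
    have inj_S: "inj_on b S" using inj S(1) by (rule inj_on_subset)
    have "finite S" using t(1) S(2) inj_S finite_image_iff by blast
    moreover have "(\<Sum>i\<in>S. scale (u (b i)) (b i)) = 0"
      using t(3) unfolding S(2) sum.reindex[OF inj_S] by simp
    moreover obtain i where "i \<in> S" "v = b i" using t(4) S by auto
    ultimately show False using indep[of S "\<lambda>i. u (b i)" i] S(1) t(5) by auto
  qed
  ultimately show ?thesis using assms(2) by (simp add: is_linear_basis_def)
qed

section \<open>Monomials indexed by the weight lattice\<close>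

lemma phi_inj: "phi a = phi b \<longleftrightarrow> a = b"
proof (cases "a \<ge> 0"; cases "b \<ge> 0")
  assume "a \<ge> 0" "\<not> b \<ge> 0"
  then show ?thesis by (simp add: phi_def eq_nat_nat_iff) presburger
next
  assume "\<not> a \<ge> 0" "b \<ge> 0"
  then show ?thesis by (simp add: phi_def eq_nat_nat_iff) presburger
qed (simp_all add: phi_def eq_nat_nat_iff)

lemma phi_surj: "\<exists>a. phi a = m"
proof (cases "even m")
  case True
  then show ?thesis by (intro exI[of _ "int (m div 2)"]) (auto simp: phi_def)
next
  case False
  then show ?thesis by (intro exI[of _ "- int ((m + 1) div 2)"]) (auto simp: phi_def elim!: oddE)
qed

text \<open>As a finitely supported exponent this turns the power of \<open>X\<close> belonging to
  \<open>l\<close> into the value of a single monomial. Bijectivity of \<open>phi\<close> makes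
  these all the monomials in the variables 1 to \<open>n\<close>.\<close>

definition weight_exponent :: "nat \<Rightarrow> (nat \<Rightarrow> int) \<Rightarrow> (nat \<Rightarrow>\<^sub>0 nat)" where
  "weight_exponent n l = (\<Sum>j\<in>{1..n}. Poly_Mapping.single j (phi (l j)))"

lemma lookup_weight_exponent:
  "Poly_Mapping.lookup (weight_exponent n l) j = (if j \<in> {1..n} then phi (l j) else 0)"
  by (simp add: weight_exponent_def lookup_sum lookup_single when_def)

lemma keys_weight_exponent: "Poly_Mapping.keys (weight_exponent n l) \<subseteq> {1..n}"
  by (auto simp: in_keys_iff lookup_weight_exponent split: if_splits)

lemma weight_exponent_inj: "inj_on (weight_exponent n) (weight_lattice n)"
proof (rule inj_onI)
  fix l m assume lm: "l \<in> weight_lattice n" "m \<in> weight_lattice n"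
    and eq: "weight_exponent n l = weight_exponent n m"
  have "l j = m j" if "j \<in> {1..n}" for j
    using arg_cong[OF eq, of "\<lambda>e. Poly_Mapping.lookup e j"] that
    unfolding lookup_weight_exponent by (simp add: phi_inj)
  then show "l = m" using lm unfolding weight_lattice_def by (rule PiE_ext[rotated 2])
qed

lemma weight_exponent_surj:
  assumes "Poly_Mapping.keys m \<subseteq> {1..n}"
  shows "\<exists>l\<in>weight_lattice n. weight_exponent n l = m"
proof -
  have "\<forall>j. \<exists>a. phi a = Poly_Mapping.lookup m j" using phi_surj by blast
  from choice[OF this] obtain f where f: "phi (f j) = Poly_Mapping.lookup m j" for j by auto
  have "weight_exponent n (restrict f {1..n}) = m"
    using assms by (intro poly_mapping_eqI) (auto simp: lookup_weight_exponent f in_keys_iff)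
  moreover have "restrict f {1..n} \<in> weight_lattice n" by (simp add: weight_lattice_def)
  ultimately show ?thesis by blast
qed

lemma monomial_weight:
  "monomial n X (\<lambda>j. phi (l j)) = monomial n X (Poly_Mapping.lookup (weight_exponent n l))"
  unfolding monomial_def
  by (intro arg_cong[where f = prod_list] map_cong)
    (auto simp: lookup_weight_exponent simp del: upt_Suc)

lemma cpoly_sum_monomials:
  fixes p :: cpoly
  shows "p = (\<Sum>m\<in>Poly_Mapping.keys p. Const (Poly_Mapping.lookup p m) * Poly_Mapping.single m 1)"
  by (rule poly_mapping_eqI)
    (simp add: Const_def mult_single lookup_sum lookup_single when_def in_keys_iff)

section \<open>Independence from leading terms\<close>

context daha
begin

lemma reduced_expression_word:
  assumes "w \<in> coxeter_group n" "reduced_expression w u"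
  shows "set u \<subseteq> {0..n}" "w = cls u" "reduced_word n u"
proof -
  show "set u \<subseteq> {0..n}" "w = cls u"
    using group_cls[OF assms(1), of u] assms(2) by (auto simp: reduced_expression_def)
  then show "reduced_word n u"
    using assms(2) by (auto simp: reduced_expression_def reduced_word_def)
qed

text \<open>For independence, look at the coefficient at an element \<open>w\<close> of maximal length among those
  that occur.\<close>
lemma basis_criterion:
  fixes D :: "cpoly \<Rightarrow> nat list set \<Rightarrow> 'a"
  assumes red: "\<And>w. w \<in> coxeter_group n \<Longrightarrow> reduced_expression w (red w)"
    and D_add: "\<And>p q w. D (p + q) w = D p w + D q w"
    and D_Const: "\<And>c p w. D (Const c * p) w = scale c (D p w)"
    and lead: "\<And>p w. w \<in> coxeter_group n \<Longrightarrow> p \<in> polys n \<Longrightarrow> p \<noteq> 0 \<Longrightarrow>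
      \<exists>g\<in>polys n. g \<noteq> 0 \<and> D p w - R (red w) * ev g \<in> filt (length (red w))"
  shows "is_linear_basis scale (weight_lattice n \<times> coxeter_group n)
    (\<lambda>(l, w). D (Poly_Mapping.single (weight_exponent n l) 1) w)
    (span {D p w | p w. p \<in> polys n \<and> w \<in> coxeter_group n})"
    (is "is_linear_basis _ ?I ?b ?V")
proof (rule is_linear_basisI)
  \<comment> \<open>\<open>D p w\<close> stands for \<open>ev p * TW (red w)\<close> or
    \<open>TW (red w) * ev p\<close>, so the two bases share one argument.\<close>
  have D_0: "D 0 w = 0" for w using D_Const[of 0 0 w] by simp
  have D_sum: "D (sum f S) w = (\<Sum>i\<in>S. D (f i) w)" for f :: "'i \<Rightarrow> cpoly" and S w
    by (induction S rule: infinite_finite_induct) (simp_all add: D_0 D_add)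
  let ?e = "\<lambda>l. Poly_Mapping.single (weight_exponent n l) (1::complex)"
  fix S :: "((nat \<Rightarrow> int) \<times> nat list set) set" and c x
  assume S: "finite S" "S \<subseteq> ?I" "(\<Sum>x\<in>S. scale (c x) (?b x)) = 0" "x \<in> S"
  \<comment> \<open>Grouping the terms by \<open>w\<close> turns the scalar relation into one with a
    polynomial \<open>p w\<close> for each group element.\<close>
  define p where "p = (\<lambda>w. \<Sum>x\<in>{x \<in> S. snd x = w}. Const (c x) * ?e (fst x))"
  have p_poly: "p w \<in> polys n" for w
    unfolding p_def
    by (intro polys_sum polys_mult polys_Const polys_single keys_weight_exponent)
  have group: "w \<in> coxeter_group n" if "w \<in> snd ` S" for w using that S(2) by auto
  \<comment> \<open>The leading part of \<open>D (p w') w'\<close> sits at \<open>w'\<close>, not at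
    \<open>w\<close>, and its error terms use words too short to represent \<open>w\<close>.\<close>
  have coef_zero: "Poly_Mapping.lookup (coef (D (p w') w')) w = 0"
    if wS: "w \<in> snd ` S" "w' \<in> snd ` S" and ne: "w' \<noteq> w"
      and le: "p w' \<noteq> 0 \<longrightarrow> length (red w') \<le> length (red w)" for w w'
  proof (cases "p w' = 0")
    case True
    then show ?thesis by (simp add: D_0 coef_0)
  next
    case False
    note W' = reduced_expression_word[OF group[OF wS(2)] red[OF group[OF wS(2)]]]
    obtain g where g: "g \<in> polys n"
        "D (p w') w' - R (red w') * ev g \<in> filt (length (red w'))" (is "?d \<in> _")
      using lead[OF group[OF wS(2)] p_poly False] by blast
    have "Poly_Mapping.lookup (coef ?d) w = 0"
    proof (rule coef_filt[OF g(2)])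
      show "length (red w') \<le> length v" if "v \<in> w" for v
        using red[OF group[OF wS(1)]] that False le
        by (auto simp: reduced_expression_def intro: order_trans)
    qed
    moreover have "Poly_Mapping.lookup (coef (R (red w') * ev g)) w = 0"
      using ne unfolding coef_R_ev[OF W'(1) g(1)] W'(2)[symmetric]
      by (simp add: lookup_single)
    ultimately have "Poly_Mapping.lookup (coef (?d + R (red w') * ev g)) w = 0"
      unfolding coef_add lookup_add by simp
    then show ?thesis by simp
  qed
  have "(\<Sum>x\<in>S. scale (c x) (?b x)) = (\<Sum>w\<in>snd ` S. D (p w) w)"
  proof -
    have "(\<Sum>x\<in>{x \<in> S. snd x = w}. scale (c x) (?b x)) = D (p w) w" for w
      unfolding p_def D_sum D_Const by (rule sum.cong) auto
    then show ?thesis using sum.image_gen[OF S(1), of "\<lambda>x. scale (c x) (?b x)" snd] by simp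
  qed
  then have total: "(\<Sum>w\<in>snd ` S. D (p w) w) = 0" using S(3) by simp
  have p_0: "p w = 0" if "w \<in> snd ` S" for w
  proof (rule ccontr)
    assume "p w \<noteq> 0"
    define M where "M = {w \<in> snd ` S. p w \<noteq> 0}"
    have M: "finite M" "M \<noteq> {}" using S(1) \<open>p w \<noteq> 0\<close> that by (auto simp: M_def)
    obtain v where v: "v \<in> M" "\<And>w'. w' \<in> M \<Longrightarrow> length (red w') \<le> length (red v)"
    proof -
      have "Max ((length \<circ> red) ` M) \<in> (length \<circ> red) ` M" using M by (intro Max_in) auto
      then obtain v where "v \<in> M" "Max ((length \<circ> red) ` M) = length (red v)" by auto
      then show ?thesis using that[of v] M(1) Max_ge[of "(length \<circ> red) ` M"] by force
    qed
    have vS: "v \<in> snd ` S" "p v \<noteq> 0" using v(1) by (auto simp: M_def)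
    note W = reduced_expression_word[OF group[OF vS(1)] red[OF group[OF vS(1)]]]
    obtain g where g: "g \<in> polys n" "g \<noteq> 0"
        "D (p v) v - R (red v) * ev g \<in> filt (length (red v))" (is "?d \<in> _")
      using lead[OF group[OF vS(1)] p_poly vS(2)] by blast
    have "Poly_Mapping.lookup (coef ?d) v = 0"
      by (rule coef_filt[OF g(3)]) (use red[OF group[OF vS(1)]] in \<open>auto simp: reduced_expression_def\<close>)
    moreover have "Poly_Mapping.lookup (coef (R (red v) * ev g)) v = g"
      unfolding coef_R_ev[OF W(1) g(1)] W(2)[symmetric] by simp
    ultimately have "Poly_Mapping.lookup (coef (?d + R (red v) * ev g)) v = g"
      unfolding coef_add lookup_add by simp
    then have "Poly_Mapping.lookup (coef (D (p v) v)) v = g" by simp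
    moreover have "(\<Sum>w\<in>snd ` S - {v}. Poly_Mapping.lookup (coef (D (p w) w)) v) = 0"
      by (rule sum.neutral) (use coef_zero vS v in \<open>auto simp: M_def\<close>)
    moreover have "(\<Sum>w\<in>snd ` S. Poly_Mapping.lookup (coef (D (p w) w)) v) = 0"
      using arg_cong[OF total, of "\<lambda>x. Poly_Mapping.lookup (coef x) v"]
      by (simp add: coef_sum coef_0 lookup_sum)
    ultimately show False
      using sum.remove[of "snd ` S" v "\<lambda>w. Poly_Mapping.lookup (coef (D (p w) w)) v"] S(1) vS g(2)
      by simp
  qed
  \<comment> \<open>Indices with the same group element have distinct exponents, so this coefficient
    of the vanishing polynomial consists of \<open>c x\<close> alone.\<close>
  have "Poly_Mapping.lookup (p (snd x)) (weight_exponent n (fst x))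
      = (\<Sum>y\<in>{y \<in> S. snd y = snd x}. if y = x then c y else 0)"
    unfolding p_def lookup_sum
  proof (rule sum.cong)
    fix y assume y: "y \<in> {y \<in> S. snd y = snd x}"
    then have xy: "fst y \<in> weight_lattice n" "fst x \<in> weight_lattice n" using S(2,4) by auto
    have iff: "weight_exponent n (fst y) = weight_exponent n (fst x) \<longleftrightarrow> y = x"
      using y inj_on_eq_iff[OF weight_exponent_inj xy] by (simp add: prod_eq_iff)
    have "Const (c y) * ?e (fst y) = Poly_Mapping.single (weight_exponent n (fst y)) (c y)"
      by (simp add: Const_def mult_single)
    then show "Poly_Mapping.lookup (Const (c y) * ?e (fst y)) (weight_exponent n (fst x))
        = (if y = x then c y else 0)"
      by (simp only: lookup_single when_def iff)
  qed simp
  also have "\<dots> = c x"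
  proof -
    have "finite {y \<in> S. snd y = snd x}" using S(1) by simp
    from sum.delta[OF this, of x c] show ?thesis using S(4) by simp
  qed
  finally show "c x = 0" using p_0[of "snd x"] S(4) by simp
next
  have D_0: "D 0 w = 0" for w using D_Const[of 0 0 w] by simp
  have D_sum: "D (sum f S) w = (\<Sum>i\<in>S. D (f i) w)" for f :: "'i \<Rightarrow> cpoly" and S w
    by (induction S rule: infinite_finite_induct) (simp_all add: D_0 D_add)
  show "span (?b ` ?I) = ?V"
  proof (rule antisym)
    have "?b ` ?I \<subseteq> {D p w | p w. p \<in> polys n \<and> w \<in> coxeter_group n}"
    proof safe
      fix l w assume "w \<in> coxeter_group n"
      then show "\<exists>p w'. D (Poly_Mapping.single (weight_exponent n l) 1) w = D p w'
          \<and> p \<in> polys n \<and> w' \<in> coxeter_group n"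
        using polys_single[OF keys_weight_exponent] by blast
    qed
    then show "span (?b ` ?I) \<subseteq> ?V" by (rule span_mono)
    have "D p w \<in> span (?b ` ?I)" if "p \<in> polys n" "w \<in> coxeter_group n" for p w
    proof -
      have "D (Poly_Mapping.single m 1) w \<in> span (?b ` ?I)" if "m \<in> Poly_Mapping.keys p" for m
      proof -
        have "Poly_Mapping.keys m \<subseteq> {1..n}" using \<open>p \<in> polys n\<close> that by (auto simp: polys_def)
        then obtain l where "l \<in> weight_lattice n" "weight_exponent n l = m"
          using weight_exponent_surj by blast
        then show ?thesis using \<open>w \<in> coxeter_group n\<close>
          by (intro span_base image_eqI[of _ _ "(l, w)"]) auto
      qed
      then have "D (\<Sum>m\<in>Poly_Mapping.keys p. Const (Poly_Mapping.lookup p m) * Poly_Mapping.single m 1) w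
          \<in> span (?b ` ?I)"
        unfolding D_sum D_Const by (intro span_sum span_scale)
      then show ?thesis using cpoly_sum_monomials[of p] by simp
    qed
    then show "?V \<subseteq> span (?b ` ?I)"
      by (intro span_minimal subspace_span) blast
  qed
qed

end

section \<open>Spanning by the chosen reduced words\<close>

context rational_daha_gens
begin

lemma Tfilt_subspace: "subspace (Tfilt m)"
  by (simp add: Tfilt_def)

lemma TW_braid_equiv:
  assumes "braid_equiv n u v"
  shows "TW u - TW v \<in> Tfilt (length u)"
  using assms
proof (induction rule: braid_equiv.induct)
  case (refl u)
  then show ?case by (simp add: subspace_0[OF Tfilt_subspace])
next
  case (sym u v)
  then show ?case
    using subspace_neg[OF Tfilt_subspace sym.IH] braid_equiv_length[OF sym.hyps] by simp
next
  case (trans u v w)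
  then show ?case
    using subspace_add[OF Tfilt_subspace, of "TW u - TW v" "length u" "TW v - TW w"]
      braid_equiv_length[OF trans.hyps(1)] by simp
next
  case (step u v l l')
  then show ?case
    using TW_mult_Tfilt[OF TW_braid_relation[OF step(3)] step(1,2)]
    by (simp add: TW_append left_diff_distrib right_diff_distrib mult.assoc add.assoc)
qed

text \<open>Where reducedness first fails, at \<open>i # u\<close> with \<open>u\<close> reduced,
  braid moves bring \<open>u\<close> to the form \<open>i # v\<close> modulo shorter words. Then
  \<open>T i * T i\<close> is a scalar and two letters disappear.\<close>

lemma TW_not_reduced:
  assumes "set u \<subseteq> {0..n}" "\<not> reduced_word n u"
  shows "TW u \<in> Tfilt (length u)"
  using assms
proof (induction u)
  case Nil
  then show ?case by (simp add: reduced_word_def)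
next
  case (Cons i u)
  then have iu: "i \<in> {0..n}" "set u \<subseteq> {0..n}" by auto
  have T_mult: "T i * x \<in> Tfilt (length (i # u))" if "x \<in> Tfilt (length u)" for x
    using TW_mult_Tfilt[OF that, of "[i]" "[]"] iu by (simp add: TW_Cons TW_Nil)
  show ?case
  proof (cases "reduced_word n u")
    case False
    then show ?thesis unfolding TW_Cons by (intro T_mult Cons.IH[OF iu(2)])
  next
    case True
    obtain v where v: "reduced_word n (i # v)" "coxeter.R (i # v) = coxeter.R u"
        "length u = Suc (length v)"
      using coxeter.reduced_left_descent[OF True iu(1) Cons.prems(2)] by blast
    obtain c where c: "T i * T i = scale c 1" by (rule T_square[OF iu(1)])
    have "braid_equiv n u (i # v)" by (rule coxeter.matsumoto[OF True v(1) v(2)[symmetric]])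
    then have "T i * (TW u - TW (i # v)) \<in> Tfilt (length (i # u))"
      by (intro T_mult TW_braid_equiv)
    moreover have "T i * TW (i # v) \<in> Tfilt (length (i # u))"
    proof -
      have "T i * TW (i # v) = scale c (TW v)"
        by (simp add: TW_Cons c flip: mult.assoc scale_mult_left)
      moreover have "TW v \<in> Tfilt (length (i # u))"
        using v(1,3) by (intro Tfilt_gen) (auto simp: reduced_word_def)
      ultimately show ?thesis by (simp only: subspace_scale[OF Tfilt_subspace])
    qed
    ultimately have "T i * (TW u - TW (i # v)) + T i * TW (i # v) \<in> Tfilt (length (i # u))"
      by (rule subspace_add[OF Tfilt_subspace])
    then show ?thesis by (simp add: TW_Cons right_diff_distrib)
  qed
qed

text \<open>A reduced word differs from the chosen one of its class by words with fewer letters, and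
  any other word is a combination of such; induction on the length concludes.\<close>

lemma TW_in_span:
  assumes red: "\<And>w. w \<in> coxeter_group n \<Longrightarrow> reduced_expression w (red w)"
    and "set u \<subseteq> {0..n}"
  shows "TW u \<in> span ((\<lambda>w. TW (red w)) ` coxeter_group n)"
  using assms(2)
proof (induction u rule: length_induct)
  case (1 u)
  let ?S = "span ((\<lambda>w. TW (red w)) ` coxeter_group n)"
  have sub: "Tfilt (length u) \<subseteq> ?S"
    unfolding Tfilt_def using 1 by (intro span_minimal subspace_span) auto
  show ?case
  proof (cases "reduced_word n u")
    case False
    then show ?thesis using TW_not_reduced 1 sub by blast
  next
    case True
    have w: "cls u \<in> coxeter_group n" using 1 by (intro cls_in_group) simp
    note W = reduced_expression_word[OF w red[OF w]]
    have "red (cls u) \<in> cls u" using red[OF w] by (simp add: reduced_expression_def)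
    then have "coxeter.R u = coxeter.R (red (cls u))" using R_equiv by blast
    then have "TW u - TW (red (cls u)) \<in> Tfilt (length u)"
      by (intro TW_braid_equiv coxeter.matsumoto True W(3))
    moreover have "TW (red (cls u)) \<in> ?S" using w by (intro span_base) simp
    ultimately have "TW u - TW (red (cls u)) + TW (red (cls u)) \<in> ?S"
      using sub by (intro span_add) auto
    then show ?thesis by simp
  qed
qed

section \<open>The subalgebra and its two spanning sets\<close>

abbreviation H :: "'a set" where "H \<equiv> rational_daha scale n r X t0 u0 tn un"

lemma is_subalgebra_hull: "is_subalgebra scale (is_subalgebra scale hull B)"
  by (rule hull_in) (auto simp: is_subalgebra_def)

lemma H_subalgebra: "is_subalgebra scale H"
  unfolding rational_daha_def by (rule is_subalgebra_hull)

lemma X_in_H: "j \<in> {1..n} \<Longrightarrow> X j \<in> H"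
  unfolding rational_daha_def by (rule hull_inc) simp

lemma T_in_H: "i \<in> {0..n} \<Longrightarrow> T i \<in> H"
  unfolding rational_daha_def T_subalgebra_def by (rule hull_inc, rule UnI1, rule hull_inc) simp

lemma H_minimal:
  assumes "is_subalgebra scale B" "\<And>i. i \<in> {0..n} \<Longrightarrow> T i \<in> B" "\<And>j. j \<in> {1..n} \<Longrightarrow> X j \<in> B"
  shows "H \<subseteq> B"
  unfolding rational_daha_def T_subalgebra_def
  using assms by (intro hull_minimal Un_least) auto

text \<open>The elements that map \<open>span G\<close> into itself by left multiplication form a
  subalgebra containing the generators, hence \<open>H\<close>. Applying them to 1 gives the
  inclusion.\<close>

lemma H_subset_span:
  assumes one: "1 \<in> span G"
    and T: "\<And>i g. i \<in> {0..n} \<Longrightarrow> g \<in> G \<Longrightarrow> T i * g \<in> span G"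
    and X: "\<And>j g. j \<in> {1..n} \<Longrightarrow> g \<in> G \<Longrightarrow> X j * g \<in> span G"
  shows "H \<subseteq> span G"
proof -
  have ext: "a * x \<in> span G" if "\<And>g. g \<in> G \<Longrightarrow> a * g \<in> span G" "x \<in> span G" for a x
    using that(2)
    by (induction rule: span_induct_alt)
      (auto simp: distrib_left span_zero simp flip: scale_mult_right intro!: span_add span_scale that(1))
  let ?B = "{a. \<forall>x\<in>span G. a * x \<in> span G}"
  have "H \<subseteq> ?B"
  proof (rule H_minimal)
    show "is_subalgebra scale ?B"
      by (auto simp: is_subalgebra_def distrib_right mult.assoc simp flip: scale_mult_left
          intro: span_add span_scale)
  qed (use ext T X in auto)
  then show ?thesis using one by fastforce
qed

lemma ev_in_H: "ev p \<in> H"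
proof -
  have H: "1 \<in> H" "\<And>a b. a \<in> H \<Longrightarrow> b \<in> H \<Longrightarrow> a + b \<in> H"
    "\<And>a b. a \<in> H \<Longrightarrow> b \<in> H \<Longrightarrow> a * b \<in> H" "\<And>c a. a \<in> H \<Longrightarrow> scale c a \<in> H"
    using H_subalgebra by (auto simp: is_subalgebra_def)
  have H_0: "0 \<in> H" using H(4)[OF H(1), of 0] by simp
  have H_sum: "sum f S \<in> H" if "\<And>m. m \<in> S \<Longrightarrow> f m \<in> H" for f :: "'i \<Rightarrow> 'a" and S
    using that by (induction S rule: infinite_finite_induct) (auto intro: H H_0)
  have H_pow: "a ^ e \<in> H" if "a \<in> H" for a and e :: nat
    by (induction e) (auto intro: H that)
  have "prod_list (map (\<lambda>j. X j ^ \<mu> j) js) \<in> H" if "set js \<subseteq> {1..n}" for js \<mu>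
    using that by (induction js) (auto intro!: H H_pow X_in_H)
  moreover have "set [1..<Suc n] \<subseteq> {1..n}" by auto
  ultimately have "monomial n X \<mu> \<in> H" for \<mu> unfolding monomial_def by blast
  then show ?thesis unfolding poly_eval_def by (intro H_sum H)
qed

lemma H_mult: "a \<in> H \<Longrightarrow> b \<in> H \<Longrightarrow> a * b \<in> H"
  using H_subalgebra by (simp add: is_subalgebra_def)

lemma TW_in_H: "set u \<subseteq> {0..n} \<Longrightarrow> TW u \<in> H"
proof (induction u)
  case Nil
  then show ?case using H_subalgebra by (simp add: TW_Nil is_subalgebra_def)
next
  case (Cons i u)
  then show ?case using H_mult[OF T_in_H, of i] by (simp add: TW_Cons)
qed

lemma span_subset_H:
  assumes "G \<subseteq> H"
  shows "span G \<subseteq> H"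
proof
  have H_0: "0 \<in> H" using H_subalgebra by (metis is_subalgebra_def scale_zero_left)
  fix x assume "x \<in> span G"
  then show "x \<in> H"
    by (induction rule: span_induct_alt)
      (use H_0 H_subalgebra assms in \<open>auto simp: is_subalgebra_def\<close>)
qed

context
  fixes red :: "nat list set \<Rightarrow> nat list"
  assumes red: "\<And>w. w \<in> coxeter_group n \<Longrightarrow> reduced_expression w (red w)"
begin

lemma red_set: "w \<in> coxeter_group n \<Longrightarrow> set (red w) \<subseteq> {0..n}"
  using reduced_expression_word red by blast

text \<open>By \<open>T_cross\<close>, \<open>T i\<close> times \<open>ev p * TW (red w)\<close> is
  a combination of \<open>TW (i # red w)\<close> and \<open>TW (red w)\<close> with polynomial
  coefficients on the left. The word \<open>i # red w\<close> may fail to be reduced, which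
  \<open>TW_in_span\<close> repairs.\<close>

lemma span_left: "span {ev p * TW (red w) | p w. p \<in> polys n \<and> w \<in> coxeter_group n} = H"
  (is "span ?G = H")
proof (rule antisym)
  show "span ?G \<subseteq> H"
    by (rule span_subset_H) (auto intro!: H_mult ev_in_H TW_in_H dest!: red_set)
  have ev_span: "ev p * x \<in> span ?G"
    if p: "p \<in> polys n" and x: "x \<in> span ((\<lambda>w. TW (red w)) ` coxeter_group n)" for p x
    using x
  proof (induction rule: span_induct_alt)
    case base
    then show ?case by (simp add: span_zero)
  next
    case (step c x y)
    then have "ev p * x \<in> ?G" using p by auto
    then show ?case using step(2)
      by (simp add: distrib_left span_add span_scale span_base flip: scale_mult_right)
  qed
  have ev_TW: "ev p * TW u \<in> span ?G" if "p \<in> polys n" "set u \<subseteq> {0..n}" for p u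
    by (rule ev_span[OF that(1) TW_in_span[OF red that(2)]])
  show "H \<subseteq> span ?G"
  proof (rule H_subset_span)
    show "1 \<in> span ?G" using ev_TW[of 1 "[]"] by (simp add: ev_1 TW_Nil)
    fix g assume "g \<in> ?G"
    then obtain p w where g: "g = ev p * TW (red w)" "p \<in> polys n" "w \<in> coxeter_group n" by blast
    show "X j * g \<in> span ?G" if j: "j \<in> {1..n}" for j
      using ev_TW[of "Var j * p" "red w"] g j red_set
      by (simp add: ev_mult ev_Var polys_mult polys_Var mult.assoc del: atLeastAtMost_iff)
    show "T i * g \<in> span ?G" if i: "i \<in> {0..n}" for i
    proof -
      obtain q where q: "q \<in> polys n" "T i * ev p = ev (act n i p) * T i + ev q"
        by (rule T_cross[OF i g(2)])
      have "T i * g = (T i * ev p) * TW (red w)" by (simp add: g mult.assoc)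
      also have "\<dots> = ev (act n i p) * TW (i # red w) + ev q * TW (red w)"
        unfolding q TW_Cons by (simp add: distrib_right mult.assoc)
      finally show ?thesis
        using ev_TW act_polys[OF n1 i] q red_set[OF g(3)] i by (simp add: span_add)
    qed
  qed
qed

text \<open>Now \<open>T i\<close> is harmless on the left, but \<open>X j\<close> must travel
  through the whole of \<open>TW (red w)\<close> to join the polynomial on the right. This is
  \<open>ev_TW\<close>, an induction on the word that uses stability under both the
  \<open>T i\<close> and right multiplication by polynomials.\<close>

lemma span_right: "span {TW (red w) * ev p | p w. p \<in> polys n \<and> w \<in> coxeter_group n} = H"
  (is "span ?G = H")
proof (rule antisym)
  show "span ?G \<subseteq> H"
    by (rule span_subset_H) (auto intro!: H_mult ev_in_H TW_in_H dest!: red_set)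
  have span_ev: "x * ev p \<in> span ?G"
    if p: "p \<in> polys n" and x: "x \<in> span ((\<lambda>w. TW (red w)) ` coxeter_group n)" for p x
    using x
  proof (induction rule: span_induct_alt)
    case base
    then show ?case by (simp add: span_zero)
  next
    case (step c x y)
    then have "x * ev p \<in> ?G" using p by auto
    then show ?case using step(2)
      by (simp add: distrib_right span_add span_scale span_base flip: scale_mult_left)
  qed
  have TW_ev: "TW u * ev p \<in> span ?G" if "p \<in> polys n" "set u \<subseteq> {0..n}" for p u
    by (rule span_ev[OF that(1) TW_in_span[OF red that(2)]])
  have T_mult: "T i * x \<in> span ?G" if i: "i \<in> {0..n}" and x: "x \<in> span ?G" for i x
    using x
  proof (induction rule: span_induct_alt)
    case base
    then show ?case by (simp add: span_zero)
  next
    case (step c x y)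
    then obtain p w where g: "x = TW (red w) * ev p" "p \<in> polys n" "w \<in> coxeter_group n" by blast
    have "T i * x \<in> span ?G"
      using TW_ev[OF g(2), of "i # red w"] red_set[OF g(3)] i by (simp add: g TW_Cons mult.assoc)
    then show ?case using step(2)
      by (simp add: distrib_left span_add span_scale flip: scale_mult_right)
  qed
  have mult_ev: "x * ev q \<in> span ?G" if x: "x \<in> span ?G" and q: "q \<in> polys n" for q x
    using x
  proof (induction rule: span_induct_alt)
    case base
    then show ?case by (simp add: span_zero)
  next
    case (step c x y)
    then obtain p w where g: "x = TW (red w) * ev p" "p \<in> polys n" "w \<in> coxeter_group n" by blast
    have "x * ev q \<in> span ?G"
      using TW_ev[OF polys_mult[OF g(2) q], of "red w"] red_set[OF g(3)]
      by (simp add: g ev_mult mult.assoc)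
    then show ?case using step(2)
      by (simp add: distrib_right span_add span_scale flip: scale_mult_left)
  qed
  have ev_TW: "ev p * TW u \<in> span ?G" if "p \<in> polys n" "set u \<subseteq> {0..n}" for p u
    using that
  proof (induction u arbitrary: p)
    case Nil
    then show ?case using TW_ev[of p "[]"] by (simp add: TW_Nil)
  next
    case (Cons i u)
    then have i: "i \<in> {0..n}" "set u \<subseteq> {0..n}" by auto
    obtain q where q: "q \<in> polys n" "ev p * T i = T i * ev (act n i p) + ev q"
      by (rule T_cross'[OF i(1) Cons.prems(1)])
    have "ev p * TW (i # u) = (ev p * T i) * TW u" by (simp add: TW_Cons mult.assoc)
    also have "\<dots> = T i * (ev (act n i p) * TW u) + ev q * TW u"
      unfolding q by (simp add: distrib_right mult.assoc)
    finally show ?case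
      using T_mult[OF i(1) Cons.IH[OF act_polys[OF n1 i(1)] i(2)]] Cons.IH[OF q(1) i(2)]
      by (simp only: span_add)
  qed
  show "H \<subseteq> span ?G"
  proof (rule H_subset_span)
    show "1 \<in> span ?G" using TW_ev[of 1 "[]"] by (simp add: ev_1 TW_Nil)
    fix g assume G: "g \<in> ?G"
    then obtain p w where g: "g = TW (red w) * ev p" "p \<in> polys n" "w \<in> coxeter_group n" by blast
    show "X j * g \<in> span ?G" if j: "j \<in> {1..n}" for j
      using mult_ev[OF ev_TW[OF polys_Var[OF j] red_set[OF g(3)]] g(2)]
      unfolding ev_Var[OF j] by (simp add: g mult.assoc)
    show "T i * g \<in> span ?G" if "i \<in> {0..n}" for i
      by (rule T_mult[OF that span_base[OF G]])
  qed
qed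

text \<open>Moving \<open>p\<close> to the right of \<open>R (red w)\<close> twists it, so the
  leading coefficient is \<open>twist (red w) p * f\<close>. In \<open>right_basis\<close> the
  polynomial already stands on the right and the coefficient is \<open>f * p\<close>.\<close>

lemma left_basis:
  "is_linear_basis scale (weight_lattice n \<times> coxeter_group n)
     (\<lambda>(l, w). monomial n X (\<lambda>j. phi (l j)) * TW (red w)) H"
proof -
  have "is_linear_basis scale (weight_lattice n \<times> coxeter_group n)
    (\<lambda>(l, w). ev (Poly_Mapping.single (weight_exponent n l) 1) * TW (red w))
    (span {ev p * TW (red w) | p w. p \<in> polys n \<and> w \<in> coxeter_group n})"
  proof (rule basis_criterion[OF red])
    fix p w assume w: "w \<in> coxeter_group n" and p: "p \<in> polys n" "p \<noteq> 0"
    let ?u = "red w"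
    have u: "set ?u \<subseteq> {0..n}" by (rule red_set[OF w])
    obtain f where f: "f \<in> polys n" "f \<noteq> 0" "TW ?u - R ?u * ev f \<in> filt (length ?u)"
      using TW_leading[OF u] by blast
    have "ev p * (TW ?u - R ?u * ev f) + (ev p * R ?u - R ?u * ev (twist ?u p)) * ev f
        \<in> filt (length ?u)"
      by (intro filt_add ev_mult_filt[OF f(3) p(1)] filt_mult_ev[OF ev_R[OF u p(1)] f(1)])
    then have "ev p * TW ?u - R ?u * ev (twist ?u p * f) \<in> filt (length ?u)"
      unfolding ev_mult by (simp add: left_diff_distrib right_diff_distrib mult.assoc)
    then show "\<exists>g\<in>polys n. g \<noteq> 0 \<and> ev p * TW ?u - R ?u * ev g \<in> filt (length ?u)"
      using f twist_polys[OF u p(1)] twist_nonzero[OF u p]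
      by (intro bexI[of _ "twist ?u p * f"]) (auto intro: polys_mult)
  qed (simp_all add: ev_add distrib_right ev_Const_mult scale_mult_left)
  then show ?thesis unfolding span_left monomial_weight ev_single by simp
qed

lemma right_basis:
  "is_linear_basis scale (weight_lattice n \<times> coxeter_group n)
     (\<lambda>(l, w). TW (red w) * monomial n X (\<lambda>j. phi (l j))) H"
proof -
  have "is_linear_basis scale (weight_lattice n \<times> coxeter_group n)
    (\<lambda>(l, w). TW (red w) * ev (Poly_Mapping.single (weight_exponent n l) 1))
    (span {TW (red w) * ev p | p w. p \<in> polys n \<and> w \<in> coxeter_group n})"
  proof (rule basis_criterion[OF red])
    fix p w assume w: "w \<in> coxeter_group n" and p: "p \<in> polys n" "p \<noteq> 0"
    let ?u = "red w"
    obtain f where f: "f \<in> polys n" "f \<noteq> 0" "TW ?u - R ?u * ev f \<in> filt (length ?u)"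
      using TW_leading[OF red_set[OF w]] by blast
    have "TW ?u * ev p - R ?u * ev (f * p) \<in> filt (length ?u)"
      using filt_mult_ev[OF f(3) p(1)]
      unfolding ev_mult by (simp add: left_diff_distrib mult.assoc)
    then show "\<exists>g\<in>polys n. g \<noteq> 0 \<and> TW ?u * ev p - R ?u * ev g \<in> filt (length ?u)"
      using f p by (intro bexI[of _ "f * p"]) (auto intro: polys_mult)
  qed (simp_all add: ev_add distrib_left ev_Const_mult scale_mult_right)
  then show ?thesis unfolding span_right monomial_weight ev_single by simp
qed

end

end

theorem proposition3p2:
  fixes n :: nat
    and t0 u0 t tn un :: complex
    and scale :: "complex \<Rightarrow> 'a::ring_1 \<Rightarrow> 'a"
    and r X :: "nat \<Rightarrow> 'a"
    and red :: "nat list set \<Rightarrow> nat list"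
  assumes "n \<ge> 2"
    and "degenerate_daha scale n (daha_k n t0 u0 t tn un) r X"
    and "\<forall>w\<in>coxeter_group n. reduced_expression w (red w)"
  shows "is_linear_basis scale (weight_lattice n \<times> coxeter_group n)
           (\<lambda>(l, w). monomial n X (\<lambda>j. phi (l j)) * T_word scale n r X t0 u0 tn un (red w))
           (rational_daha scale n r X t0 u0 tn un)
       \<and> is_linear_basis scale (weight_lattice n \<times> coxeter_group n)
           (\<lambda>(l, w). T_word scale n r X t0 u0 tn un (red w) * monomial n X (\<lambda>j. phi (l j)))
           (rational_daha scale n r X t0 u0 tn un)"
proof -
  interpret degenerate_daha scale n "daha_k n t0 u0 t tn un" r X by (rule assms(2))
  interpret rational_daha_gens scale n t0 u0 t tn un r X
    by unfold_locales (rule assms(1))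
  show ?thesis using left_basis right_basis assms(3) by blast
qed

end
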